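(* Let $\mathbb{U}_1$ be the Urysohn metric space of diameter one and let $\mathrm{Iso}(\mathbb{U}_1)$ be the topological group of all isometries of $\mathbb{U}_1$ onto itself with the topology of pointwise convergence. Then every continuous weakly almost periodic function on $\mathrm{Iso}(\mathbb{U}_1)$ is constant.
   Context: The Urysohn space of diameter one, $\mathbb{U}_1$, is the (unique up to isometry) metric space such that: (1) $\mathbb{U}_1$ is a complete separable metric space of diameter $1$, where the diameter of a metric space $X$ is $\sup\{d(x,y)\colon x,y\in X\}$; (2) every isometry between two finite metric subspaces of $\mathbb{U}_1$ extends to a global isometry of $\mathbb{U}_1$ onto itself; (3) $\mathbb{U}_1$ contains an isometric copy of every separable metric space of diameter one. A bounded continuous function $f$ on a topological group $G$ is weakly almost periodic if the set of its translates $\{x\mapsto f(gx)\colon g\in G\}$ is relatively weakly compact in the Banach space of bounded continuous functions on $G$ with the supremum norm. *)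

theory Defs
  imports "HOL-Analysis.Analysis"
begin

section \<open>The Urysohn space of diameter one\<close>

text \<open>The supremum is taken in the extended reals, so it is \<open>-\<infinity>\<close> for the empty space and
  \<open>\<infinity>\<close> for an unbounded one; diameter one therefore entails nonempty and bounded.\<close>

definition mdiameter :: "'a metric \<Rightarrow> ereal" where
  "mdiameter m = (SUP x\<in>mspace m. SUP y\<in>mspace m. ereal (mdist m x y))"

definition isometric_embedding :: "'a metric \<Rightarrow> 'b metric \<Rightarrow> ('a \<Rightarrow> 'b) \<Rightarrow> bool" where
  "isometric_embedding m m' f \<longleftrightarrow>
     f \<in> mspace m \<rightarrow> mspace m' \<and>
     (\<forall>x\<in>mspace m. \<forall>y\<in>mspace m. mdist m' (f x) (f y) = mdist m x y)"

definition global_isometry :: "('a::metric_space \<Rightarrow> 'a) \<Rightarrow> bool" where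
  "global_isometry g \<longleftrightarrow> bij g \<and> (\<forall>x y. dist (g x) (g y) = dist x y)"

text \<open>In the last clause the separable metric spaces range over those whose carrier is a set of
  reals.  This is no restriction, because a separable metric space has at most continuum many points:
  see \<open>urysohn_space_1_universal\<close> below.\<close>

definition urysohn_space_1 :: "'a::metric_space itself \<Rightarrow> bool" where
  "urysohn_space_1 (_ :: 'a itself) \<longleftrightarrow>
     complete (UNIV :: 'a set) \<and>
     separable_space (euclidean :: 'a topology) \<and>
     mdiameter (euclidean_metric :: 'a metric) = 1 \<and>
     (\<forall>(A :: 'a set) h. finite A \<and> (\<forall>x\<in>A. \<forall>y\<in>A. dist (h x) (h y) = dist x y) \<longrightarrow>
        (\<exists>g. global_isometry g \<and> (\<forall>x\<in>A. g x = h x))) \<and>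
     (\<forall>m :: real metric. separable_space (mtopology_of m) \<and> mdiameter m = 1 \<longrightarrow>
        (\<exists>f. isometric_embedding m (euclidean_metric :: 'a metric) f))"

lemma separable_metric_inj_real:
  assumes "separable_space (mtopology_of m)"
  shows "\<exists>j :: 'b \<Rightarrow> real. inj_on j (mspace m)"
proof -
  interpret Metric_space "mspace m" "mdist m" by simp
  obtain C where C: "countable C" "C \<subseteq> mspace m" "mtopology closure_of C = mspace m"
    using assms unfolding separable_space_def by (auto simp: mtopology_of_def)
  define code where "code x = {(to_nat_on C c, q :: rat) | c q. c \<in> C \<and> mdist m x c < of_rat q}" for x
  have inj: "inj_on code (mspace m)"
  proof (rule inj_onI, rule ccontr)
    fix x y assume x: "x \<in> mspace m" and y: "y \<in> mspace m" and eq: "code x = code y" and "x \<noteq> y"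
    then have pos: "mdist m x y > 0" by simp
    have "x \<in> mtopology closure_of C" using C x by simp
    then obtain c where c: "c \<in> C" "mdist m x c < mdist m x y / 2"
      using pos by (force simp: metric_closure_of in_mball dest: spec[of _ "mdist m x y / 2"])
    obtain q where q: "mdist m x c < of_rat q" "of_rat q < mdist m x y / 2"
      using of_rat_dense[OF c(2)] by blast
    have "(to_nat_on C c, q) \<in> code x" using c q by (auto simp: code_def)
    then have "(to_nat_on C c, q) \<in> code y" using eq by simp
    then obtain c' where "c' \<in> C" "to_nat_on C c' = to_nat_on C c" "mdist m y c' < of_rat q"
      by (auto simp: code_def)
    then have "mdist m y c < of_rat q"
      using C c inj_on_to_nat_on[OF C(1)] by (metis inj_onD)
    then have "mdist m x c + mdist m y c < mdist m x y" using q by simp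
    moreover have "mdist m x y \<le> mdist m x c + mdist m y c"
      using triangle'[of x c y] mdist_triangle[of x m c y] mdist_commute[of m c y] C c x y by auto
    ultimately show False by simp
  qed
  obtain r :: "nat set \<Rightarrow> real" where r: "inj r"
    using nat_sets_eqpoll_reals unfolding eqpoll_def bij_betw_def by auto
  have "inj_on (\<lambda>x. r (to_nat ` code x)) (mspace m)"
  proof (rule inj_onI)
    fix x y assume "x \<in> mspace m" "y \<in> mspace m" "r (to_nat ` code x) = r (to_nat ` code y)"
    then show "x = y"
      using inj by (metis injD[OF r] inj_image_eq_iff[OF inj_to_nat] inj_onD)
  qed
  then show ?thesis by blast
qed

lemma urysohn_space_1_universal:
  fixes m :: "'b metric"
  assumes U: "urysohn_space_1 TYPE('a::metric_space)"
    and sep: "separable_space (mtopology_of m)" and dm: "mdiameter m = 1"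
  shows "\<exists>f. isometric_embedding m (euclidean_metric :: 'a metric) f"
proof -
  obtain j :: "'b \<Rightarrow> real" where j: "inj_on j (mspace m)"
    using separable_metric_inj_real[OF sep] by blast
  define i where "i = the_inv_into (mspace m) j"
  define N where "N = j ` mspace m"
  have ij: "i (j x) = x" if "x \<in> mspace m" for x
    using j that by (simp add: i_def the_inv_into_f_f)
  define d where "d x y = mdist m (i x) (i y)" for x y
  have M: "Metric_space N d"
    by unfold_locales (auto simp: N_def d_def ij mdist_commute mdist_triangle)
  define n where "n = metric (N, d)"
  have n: "mspace n = N" "mdist n = d"
    by (simp_all add: n_def Metric_space.mspace_metric[OF M] Metric_space.mdist_metric[OF M])
  have iso: "mdist n (j x) (j y) = mdist m x y" if "x \<in> mspace m" "y \<in> mspace m" for x y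
    using that by (simp add: n d_def ij)
  have "mdiameter n = mdiameter m"
    unfolding mdiameter_def n(1) N_def image_image by (intro SUP_cong) (auto simp: iso)
  moreover have "separable_space (mtopology_of n)"
  proof -
    interpret Metric_space12 "mspace m" "mdist m" "mspace n" "mdist n"
      by (simp add: Metric_space12_def)
    have "homeomorphic_map M1.mtopology M2.mtopology j"
      by (rule isometry_imp_homeomorphic_map) (auto simp: n(1) N_def iso)
    then have "mtopology_of m homeomorphic_space mtopology_of n"
      unfolding mtopology_of_def by (rule homeomorphic_map_imp_homeomorphic_space)
    then show ?thesis using sep homeomorphic_separable_space by blast
  qed
  ultimately obtain f where f: "isometric_embedding n (euclidean_metric :: 'a metric) f"
    using U dm unfolding urysohn_space_1_def by metis
  have "isometric_embedding m (euclidean_metric :: 'a metric) (f \<circ> j)"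
    using f iso by (auto simp: isometric_embedding_def n(1) N_def)
  then show ?thesis by blast
qed

section \<open>The topological group of isometries\<close>

typedef (overloaded) 'a isometry = "{g :: 'a::metric_space \<Rightarrow> 'a. global_isometry g}"
  morphisms app_iso Abs_isometry
  by (rule exI[of _ id]) (simp add: global_isometry_def)

setup_lifting type_definition_isometry

text \<open>The topology on functions \<open>'a \<Rightarrow> 'a\<close> is the product topology, that is, the topology of
  pointwise convergence; \<open>'a isometry\<close> carries the subspace topology.\<close>

instantiation isometry :: (metric_space) topological_space
begin

definition open_isometry :: "'a isometry set \<Rightarrow> bool" where
  "open_isometry S \<longleftrightarrow> (\<exists>T :: ('a \<Rightarrow> 'a) set. open T \<and> S = app_iso -` T)"

instance
proof
  show "open (UNIV :: 'a isometry set)"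
    unfolding open_isometry_def by (rule exI[of _ UNIV]) simp
next
  fix S T :: "'a isometry set" assume "open S" "open T"
  then show "open (S \<inter> T)"
    unfolding open_isometry_def by (metis open_Int vimage_Int)
next
  fix K :: "'a isometry set set" assume "\<forall>S\<in>K. open S"
  then obtain T where "\<And>S. S \<in> K \<Longrightarrow> open (T S) \<and> S = app_iso -` T S"
    unfolding open_isometry_def by metis
  then have "open (\<Union>(T ` K)) \<and> \<Union>K = app_iso -` \<Union>(T ` K)"
    by blast
  then show "open (\<Union>K)"
    unfolding open_isometry_def by blast
qed

end

lemma continuous_on_app_iso: "continuous_on UNIV (\<lambda>g :: 'a::metric_space isometry. app_iso g x)"
proof (rule continuous_on_product_then_coordinatewise)
  show "continuous_on UNIV (app_iso :: 'a isometry \<Rightarrow> 'a \<Rightarrow> 'a)"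
    unfolding continuous_on_open_vimage[OF open_UNIV] by (auto simp: open_isometry_def)
qed

lemma tendsto_isometry_iff:
  fixes g :: "'i \<Rightarrow> 'a::metric_space isometry"
  shows "(g \<longlongrightarrow> l) F \<longleftrightarrow> (\<forall>x. ((\<lambda>i. app_iso (g i) x) \<longlongrightarrow> app_iso l x) F)"
proof safe
  fix x assume "(g \<longlongrightarrow> l) F"
  then show "((\<lambda>i. app_iso (g i) x) \<longlongrightarrow> app_iso l x) F"
    using continuous_on_tendsto_compose[OF continuous_on_app_iso] by force
next
  assume *: "\<forall>x. ((\<lambda>i. app_iso (g i) x) \<longlongrightarrow> app_iso l x) F"
  show "(g \<longlongrightarrow> l) F"
  proof (rule topological_tendstoI)
    fix S assume "open S" "l \<in> S"
    then obtain T where T: "open T" "S = app_iso -` T" "app_iso l \<in> T"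
      by (auto simp: open_isometry_def)
    obtain X where X: "app_iso l \<in> Pi\<^sub>E UNIV X" "\<And>i. open (X i)" "finite {i. X i \<noteq> UNIV}"
        "Pi\<^sub>E UNIV X \<subseteq> T"
      using product_topology_open_contains_basis[of "\<lambda>_. euclidean" UNIV T "app_iso l"] T
      by (auto simp: open_fun_def)
    have "\<forall>\<^sub>F i in F. \<forall>x\<in>{x. X x \<noteq> UNIV}. app_iso (g i) x \<in> X x"
      using * X by (intro eventually_ball_finite ballI) (auto intro!: topological_tendstoD)
    then show "\<forall>\<^sub>F i in F. g i \<in> S"
    proof eventually_elim
      case (elim i)
      then have "app_iso (g i) y \<in> X y" for y by (cases "X y = UNIV") auto
      then have "app_iso (g i) \<in> Pi\<^sub>E UNIV X" by (simp add: PiE_iff)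
      then show ?case using X(4) T(2) by blast
    qed
  qed
qed

lemma tendsto_app_iso:
  "(g \<longlongrightarrow> l) F \<Longrightarrow> ((\<lambda>i. app_iso (g i) x) \<longlongrightarrow> app_iso l x) F"
  by (simp add: tendsto_isometry_iff)

text \<open>\<^class>\<open>topological_group_add\<close> is the library's class of (not necessarily commutative)
  topological groups.  It is written additively, so composition of isometries becomes \<open>+\<close>.\<close>

instantiation isometry :: (metric_space) group_add
begin

lift_definition zero_isometry :: "'a isometry" is id
  by (simp add: global_isometry_def)

lift_definition plus_isometry :: "'a isometry \<Rightarrow> 'a isometry \<Rightarrow> 'a isometry" is "(\<circ>)"
  by (simp add: global_isometry_def bij_comp)

lift_definition uminus_isometry :: "'a isometry \<Rightarrow> 'a isometry" is inv
proof -
  fix g :: "'a \<Rightarrow> 'a" assume g: "global_isometry g"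
  have "dist (inv g x) (inv g y) = dist (g (inv g x)) (g (inv g y))" for x y
    using g by (simp add: global_isometry_def)
  then show "global_isometry (inv g)"
    using g by (simp add: global_isometry_def bij_imp_bij_inv bij_is_surj surj_f_inv_f)
qed

definition minus_isometry :: "'a isometry \<Rightarrow> 'a isometry \<Rightarrow> 'a isometry" where
  "minus_isometry g h = g + - h"

instance
proof
  fix a b c :: "'a isometry"
  show "a + b + c = a + (b + c)" by transfer (simp add: comp_assoc)
  show "0 + a = a" by transfer simp
  show "a + 0 = a" by transfer simp
  show "- a + a = 0" by transfer (simp add: global_isometry_def bij_is_inj)
  show "a + - b = a - b" by (simp add: minus_isometry_def)
qed

end

instance isometry :: (metric_space) topological_group_add
proof
  fix a b :: "'a isometry"
  show "((\<lambda>x. fst x + snd x) \<longlongrightarrow> a + b) (nhds a \<times>\<^sub>F nhds b)"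
  proof (rule tendsto_isometry_iff[THEN iffD2, rule_format])
    fix x
    let ?F = "nhds a \<times>\<^sub>F nhds b"
    have fst: "((\<lambda>p. app_iso (fst p) (app_iso b x)) \<longlongrightarrow> app_iso a (app_iso b x)) ?F"
      by (rule tendsto_app_iso[OF filterlim_fst])
    have snd: "((\<lambda>p. app_iso (snd p) x) \<longlongrightarrow> app_iso b x) ?F"
      by (rule tendsto_app_iso[OF filterlim_snd])
    have lim: "((\<lambda>p. dist (app_iso (snd p) x) (app_iso b x) +
        dist (app_iso (fst p) (app_iso b x)) (app_iso a (app_iso b x))) \<longlongrightarrow> 0) ?F"
      using tendsto_add[OF snd[THEN tendsto_dist_iff[THEN iffD1]] fst[THEN tendsto_dist_iff[THEN iffD1]]]
      by simp
    have le: "dist (app_iso (fst p + snd p) x) (app_iso (a + b) x) \<le>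
        dist (app_iso (snd p) x) (app_iso b x) +
        dist (app_iso (fst p) (app_iso b x)) (app_iso a (app_iso b x))" for p
    proof -
      have "dist (app_iso (snd p) x) (app_iso b x) =
          dist (app_iso (fst p) (app_iso (snd p) x)) (app_iso (fst p) (app_iso b x))"
        using app_iso[of "fst p"] by (simp add: global_isometry_def)
      then show ?thesis by (simp add: plus_isometry.rep_eq dist_triangle)
    qed
    show "((\<lambda>p. app_iso (fst p + snd p) x) \<longlongrightarrow> app_iso (a + b) x) ?F"
      unfolding tendsto_dist_iff[of _ "app_iso (a + b) x"]
      by (rule tendsto_sandwich[OF _ _ tendsto_const lim]) (auto intro!: always_eventually le)
  qed
next
  fix a :: "'a isometry"
  show "(uminus \<longlongrightarrow> - a) (nhds a)"
  proof (rule tendsto_isometry_iff[THEN iffD2, rule_format])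
    fix x
    let ?y = "app_iso (- a) x"
    have inv: "app_iso g (app_iso (- g) x) = x" for g :: "'a isometry"
      using app_iso[of g] by (simp add: uminus_isometry.rep_eq global_isometry_def bij_def surj_f_inv_f)
    have "dist (app_iso (- g) x) ?y = dist (app_iso g ?y) (app_iso a ?y)" for g
      using app_iso[of g] inv by (metis dist_commute global_isometry_def mem_Collect_eq)
    moreover have "((\<lambda>g. app_iso g ?y) \<longlongrightarrow> app_iso a ?y) (nhds a)"
      by (rule tendsto_app_iso[OF filterlim_ident])
    ultimately show "((\<lambda>g. app_iso (- g) x) \<longlongrightarrow> ?y) (nhds a)"
      unfolding tendsto_dist_iff[of _ ?y] tendsto_dist_iff[of _ "app_iso a ?y"] by simp
  qed
qed

section \<open>Weakly almost periodic functions\<close>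

text \<open>The weak topology is the initial topology of the bounded linear functionals.  On a complex
  space, the real-linear functionals used here and the complex-linear ones induce the same initial
  topology: the former are exactly the real parts of the latter, and a complex-linear \<open>\<phi>\<close> is
  \<open>x \<mapsto> Re (\<phi> x) - \<i> * Re (\<phi> (\<i> * x))\<close>.\<close>

definition weak_topology :: "'v::real_normed_vector topology" where
  "weak_topology = pullback_topology UNIV (\<lambda>x (\<phi> :: 'v \<Rightarrow>\<^sub>L real). blinfun_apply \<phi> x) euclidean"

context includes bcontfun.lifting begin

lift_definition left_translate ::
  "'g::topological_group_add \<Rightarrow> ('g \<Rightarrow>\<^sub>C 'b::real_normed_vector) \<Rightarrow> ('g \<Rightarrow>\<^sub>C 'b)"
  is "\<lambda>g f x. f (g + x)"
proof -
  fix g :: 'g and f :: "'g \<Rightarrow> 'b" assume f: "f \<in> bcontfun"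
  then have "continuous_on UNIV (\<lambda>x. f (g + x))"
    by (auto simp: bcontfun_def intro!: continuous_intros
        continuous_on_compose2[of UNIV f UNIV "\<lambda>x. g + x"])
  moreover have "bounded (range (\<lambda>x. f (g + x)))"
    using f by (auto simp: bcontfun_def elim!: bounded_subset)
  ultimately show "(\<lambda>x. f (g + x)) \<in> bcontfun" by (simp add: bcontfun_def)
qed

end

text \<open>Functions of type \<open>'g \<Rightarrow>\<^sub>C 'b\<close> are bounded and continuous by construction, and their norm is
  the supremum norm.\<close>

definition weakly_almost_periodic ::
  "('g::topological_group_add \<Rightarrow>\<^sub>C 'b::real_normed_vector) \<Rightarrow> bool" where
  "weakly_almost_periodic f \<longleftrightarrow>
     compactin weak_topology (weak_topology closure_of range (\<lambda>g. left_translate g f))"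

end

theory Submission
  imports Defs
begin

text \<open>Let \<open>f\<close> be a real-valued weakly almost periodic function on the group of isometries of the
  Urysohn space of diameter one.  The only consequence of weak compactness that the argument needs is
  Grothendieck's double limit property: the two iterated limits of an array \<open>f (g\<^sub>n + h\<^sub>m)\<close> agree
  whenever they exist.

  This property has two uses.  First, in an isometry group of a complete separable space it forces
  uniform continuity on both sides: for every \<open>e > 0\<close> there is a finite set \<open>A\<close> such that
  \<open>f (u + x + v)\<close> is \<open>e\<close>-close to \<open>f x\<close> for all \<open>x\<close> and all \<open>u\<close>, \<open>v\<close> fixing \<open>A\<close> pointwise
  (\<open>nearly_fixator_biinvariant\<close>).  By homogeneity of the Urysohn space, the double coset of an
  isometry \<open>k\<close> modulo the pointwise stabiliser of \<open>A\<close> is determined by the matrix of distances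
  between \<open>k a\<close> and \<open>b\<close> for \<open>a\<close>, \<open>b\<close> in \<open>A\<close>, so up to \<open>e\<close> the value \<open>f k\<close> depends on this matrix
  only.

  Secondly, it excludes that \<open>f\<close> recognises an order.  Consider the matrices
  \<open>min 1 (dist a b + c)\<close>.  The triangle inequality permits copies \<open>X\<^sub>n\<close> and \<open>Y\<^sub>m\<close> of \<open>A\<close> whose mutual
  position has parameter \<open>c\<close> for \<open>m < n\<close> and \<open>3 * c\<close> for \<open>n < m\<close>: the detour from \<open>X\<^sub>n\<close> to \<open>Y\<^sub>m\<close>
  through another pair has length \<open>c + c + c\<close>.  Universality realises this configuration, and
  homogeneity provides isometries \<open>g\<^sub>n\<close>, \<open>h\<^sub>m\<close> with the matrix of \<open>g\<^sub>n + h\<^sub>m\<close> being the one with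
  parameter \<open>c\<close> or \<open>3 * c\<close> according to the order of \<open>n\<close> and \<open>m\<close>.  Hence the values of \<open>f\<close> at
  parameters \<open>c\<close> and \<open>3 * c\<close> are nearly equal (\<open>value_at_tripled_displacement\<close>).  For small \<open>c\<close>
  the value is near \<open>f 0\<close> by continuity at the identity, and finitely many triplings lead to the
  matrix with all entries \<open>1\<close>.  So \<open>f k\<close> is near \<open>f 0\<close> for every \<open>k\<close> that moves a suitable finite
  set to distance one from itself (\<open>value_at_far_displacement\<close>).

  Such \<open>k\<close> form a class that is almost insensitive to left translation by a given \<open>g\<close>.  Comparing the
  last statement for \<open>f\<close> and for \<open>\<lambda>x. f (g + x)\<close> at one common \<open>k\<close> gives \<open>f g = f 0\<close>.  Complex-valued
  functions are treated through their real and imaginary parts.\<close>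

section \<open>Weak almost periodicity and iterated limits\<close>

lemma LIMSEQ_eq_cluster_value:
  fixes X :: "nat \<Rightarrow> real"
  assumes "X \<longlonglongrightarrow> L" and "\<And>e. e > 0 \<Longrightarrow> \<exists>\<^sub>F n in sequentially. \<bar>X n - c\<bar> < e"
  shows "L = c"
proof (rule ccontr)
  assume "L \<noteq> c"
  then have e: "\<bar>L - c\<bar> / 2 > 0" by simp
  have "\<forall>\<^sub>F n in sequentially. \<bar>X n - L\<bar> < \<bar>L - c\<bar> / 2"
    using tendstoD[OF assms(1) e] by (simp add: dist_real_def)
  with assms(2)[OF e] have "\<exists>\<^sub>F n in sequentially. \<bar>X n - L\<bar> < \<bar>L - c\<bar> / 2 \<and> \<bar>X n - c\<bar> < \<bar>L - c\<bar> / 2"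
    by (rule frequently_eventually_conj)
  then show False
    by (rule frequentlyE) (auto simp: abs_real_def field_simps split: if_splits)
qed

lemma compactin_sequence_cluster_point:
  assumes K: "compactin X K" and u: "\<And>n::nat. u n \<in> K"
  obtains p where "p \<in> K" "\<And>V. \<lbrakk>openin X V; p \<in> V\<rbrakk> \<Longrightarrow> \<exists>\<^sub>F n in sequentially. u n \<in> V"
proof -
  have "\<exists>p\<in>K. \<forall>V. openin X V \<and> p \<in> V \<longrightarrow> (\<exists>\<^sub>F n in sequentially. u n \<in> V)"
  proof (rule ccontr)
    assume "\<not> ?thesis"
    then obtain V where V: "\<And>p. p \<in> K \<Longrightarrow> openin X (V p) \<and> p \<in> V p \<and> (\<forall>\<^sub>F n in sequentially. u n \<notin> V p)"
      unfolding not_frequently[symmetric] by metis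
    have "\<exists>\<F>. finite \<F> \<and> \<F> \<subseteq> V ` K \<and> K \<subseteq> \<Union>\<F>"
      using K V unfolding compactin_def by (auto dest!: spec[of _ "V ` K"])
    then obtain P where P: "finite P" "P \<subseteq> K" "K \<subseteq> \<Union>(V ` P)"
      using finite_subset_image by metis
    have "\<forall>\<^sub>F n in sequentially. \<forall>p\<in>P. u n \<notin> V p"
      using P V by (intro eventually_ball_finite ballI) auto
    then obtain n where "\<forall>p\<in>P. u n \<notin> V p"
      using eventually_happens'[OF sequentially_bot] by blast
    with P(3) u[of n] show False by blast
  qed
  then show ?thesis using that by blast
qed

lemma openin_weak_topology_blinfun:
  fixes \<phi> :: "'v::real_normed_vector \<Rightarrow>\<^sub>L real"
  shows "openin weak_topology {x. \<bar>\<phi> x - c\<bar> < e}"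
proof -
  have "open ((\<lambda>u :: ('v \<Rightarrow>\<^sub>L real) \<Rightarrow> real. u \<phi>) -` ball c e)"
    by (intro open_vimage open_ball continuous_on_product_coordinates)
  then show ?thesis
    unfolding weak_topology_def openin_pullback_topology
    by (intro exI[of _ "(\<lambda>u. u \<phi>) -` ball c e"])
      (auto simp: dist_real_def abs_minus_commute)
qed

text \<open>A form of the Banach-Alaoglu theorem: by Tychonoff the functionals have a cluster point among all
  functions \<open>'v \<Rightarrow> real\<close>, and linearity passes to it because it involves only three
  coordinates at a time.\<close>
lemma bounded_functionals_cluster:
  fixes \<psi> :: "nat \<Rightarrow> 'v::real_normed_vector \<Rightarrow> real"
  assumes lin: "\<And>m. bounded_linear (\<psi> m)" and B: "\<And>m v. \<bar>\<psi> m v\<bar> \<le> B * norm v"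
  obtains \<phi> :: "'v \<Rightarrow>\<^sub>L real"
  where "\<And>v e. e > 0 \<Longrightarrow> \<exists>\<^sub>F m in sequentially. \<bar>\<psi> m v - \<phi> v\<bar> < e"
proof -
  let ?X = "product_topology (\<lambda>_::'v. euclideanreal) UNIV"
  have "compactin ?X (Pi\<^sub>E UNIV (\<lambda>v. {- (B * norm v)..B * norm v}))"
    by (simp add: compactin_PiE)
  moreover have "\<psi> m \<in> Pi\<^sub>E UNIV (\<lambda>v. {- (B * norm v)..B * norm v})" for m
    using B[of m] by (simp add: PiE_iff abs_le_iff minus_le_iff)
  ultimately obtain \<Phi> where \<Phi>: "\<Phi> \<in> Pi\<^sub>E UNIV (\<lambda>v. {- (B * norm v)..B * norm v})"
    and cl: "\<And>V. \<lbrakk>openin ?X V; \<Phi> \<in> V\<rbrakk> \<Longrightarrow> \<exists>\<^sub>F m in sequentially. \<psi> m \<in> V"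
    by (rule compactin_sequence_cluster_point[where u = \<psi>]) blast
  have near: "\<exists>\<^sub>F m in sequentially. \<forall>v\<in>S. \<bar>\<psi> m v - \<Phi> v\<bar> < e" if "finite S" "e > 0" for S e
  proof -
    have "open (\<Inter>v\<in>S. (\<lambda>u::'v \<Rightarrow> real. u v) -` ball (\<Phi> v) e)"
      using that(1) by (intro open_INT ballI open_vimage open_ball continuous_on_product_coordinates)
    then have "openin ?X (\<Inter>v\<in>S. (\<lambda>u. u v) -` ball (\<Phi> v) e)"
      by (simp add: open_fun_def)
    from cl[OF this] that(2) show ?thesis
      by (auto simp: dist_real_def abs_minus_commute elim: frequently_elim1)
  qed
  have "bounded_linear \<Phi>"
  proof (rule bounded_linear_intro[where K = B])
    fix u v
    show "\<Phi> (u + v) = \<Phi> u + \<Phi> v"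
    proof (rule ccontr)
      assume "\<Phi> (u + v) \<noteq> \<Phi> u + \<Phi> v"
      then have "\<bar>\<Phi> (u + v) - (\<Phi> u + \<Phi> v)\<bar> / 3 > 0" by simp
      from near[OF _ this, of "{u, v, u + v}"] obtain m
        where "\<forall>w\<in>{u, v, u + v}. \<bar>\<psi> m w - \<Phi> w\<bar> < \<bar>\<Phi> (u + v) - (\<Phi> u + \<Phi> v)\<bar> / 3"
        by (auto elim: frequentlyE)
      moreover have "\<psi> m (u + v) = \<psi> m u + \<psi> m v"
        using lin by (simp add: linear_simps)
      ultimately show False by (auto simp: abs_real_def field_simps split: if_splits)
    qed
  next
    fix r :: real and v
    show "\<Phi> (r *\<^sub>R v) = r *\<^sub>R \<Phi> v"
    proof (rule ccontr)
      assume *: "\<Phi> (r *\<^sub>R v) \<noteq> r *\<^sub>R \<Phi> v"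
      define e where "e = \<bar>\<Phi> (r *\<^sub>R v) - r * \<Phi> v\<bar> / (1 + \<bar>r\<bar>)"
      have pos: "1 + \<bar>r\<bar> > 0" by linarith
      have "e > 0" using * pos by (simp add: e_def)
      from near[OF _ this, of "{v, r *\<^sub>R v}"] obtain m
        where m: "\<bar>\<psi> m v - \<Phi> v\<bar> < e" "\<bar>\<psi> m (r *\<^sub>R v) - \<Phi> (r *\<^sub>R v)\<bar> < e"
        by (auto elim: frequentlyE)
      have "\<psi> m (r *\<^sub>R v) = r * \<psi> m v"
        using lin by (simp add: linear_simps)
      then have "\<Phi> (r *\<^sub>R v) - r * \<Phi> v = r * (\<psi> m v - \<Phi> v) - (\<psi> m (r *\<^sub>R v) - \<Phi> (r *\<^sub>R v))"
        by (simp add: algebra_simps)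
      then have "\<bar>\<Phi> (r *\<^sub>R v) - r * \<Phi> v\<bar> \<le> \<bar>r\<bar> * \<bar>\<psi> m v - \<Phi> v\<bar> + \<bar>\<psi> m (r *\<^sub>R v) - \<Phi> (r *\<^sub>R v)\<bar>"
        by (metis abs_mult abs_triangle_ineq4)
      also have "\<dots> < \<bar>r\<bar> * e + e"
        using m by (intro add_le_less_mono mult_left_mono) auto
      also have "\<dots> = (1 + \<bar>r\<bar>) * e"
        by (simp add: algebra_simps)
      also have "\<dots> = \<bar>\<Phi> (r *\<^sub>R v) - r * \<Phi> v\<bar>"
        using pos by (simp add: e_def)
      finally show False by simp
    qed
  next
    fix v show "norm (\<Phi> v) \<le> norm v * B"
      using \<Phi> by (auto simp: PiE_iff abs_le_iff minus_le_iff mult.commute)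
  qed
  then show ?thesis
    using near[of "{_}"] by (intro that[of "Blinfun \<Phi>"]) (auto simp: bounded_linear_Blinfun_apply)
qed

definition double_limit :: "('g::plus \<Rightarrow> real) \<Rightarrow> bool" where
  "double_limit f \<longleftrightarrow> (\<forall>g h r s R S.
     (\<forall>n::nat. (\<lambda>m::nat. f (g n + h m)) \<longlonglongrightarrow> r n) \<and> r \<longlonglongrightarrow> R \<and>
     (\<forall>m. (\<lambda>n. f (g n + h m)) \<longlonglongrightarrow> s m) \<and> s \<longlonglongrightarrow> S \<longrightarrow> R = S)"

text \<open>The easy half of Grothendieck's criterion.  Let \<open>F\<close> be a weak cluster point of the translates by
  \<open>g n\<close>, and let \<open>\<phi>\<close> be a cluster point of the evaluation functionals at \<open>h m\<close>.  Both iterated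
  limits are then equal to \<open>\<phi> F\<close>.  The functional \<open>l\<close> reduces vector values to real ones.\<close>
lemma weakly_almost_periodic_imp_double_limit:
  fixes f :: "'g::topological_group_add \<Rightarrow>\<^sub>C 'b::real_normed_vector"
  assumes wap: "weakly_almost_periodic f" and l: "bounded_linear l"
  shows "double_limit (\<lambda>x. l (f x))"
  unfolding double_limit_def
proof (intro allI impI, elim conjE)
  fix g h :: "nat \<Rightarrow> 'g" and r s :: "nat \<Rightarrow> real" and R S
  assume r: "\<forall>n. (\<lambda>m. l (f (g n + h m))) \<longlonglongrightarrow> r n" "r \<longlonglongrightarrow> R"
    and s: "\<forall>m. (\<lambda>n. l (f (g n + h m))) \<longlonglongrightarrow> s m" "s \<longlonglongrightarrow> S"
  define T where "T n = left_translate (g n) f" for n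
  have T: "T n x = f (g n + x)" for n x
    by (simp add: T_def left_translate.rep_eq)
  obtain B where B: "\<And>x. norm (l x) \<le> norm x * B" "B \<ge> 0"
    using bounded_linear.nonneg_bounded[OF l] by blast
  have ev_le: "\<bar>l (u (h m))\<bar> \<le> B * norm u" for u :: "'g \<Rightarrow>\<^sub>C 'b" and m
  proof -
    have "\<bar>l (u (h m))\<bar> \<le> norm (u (h m)) * B" using B(1)[of "u (h m)"] by simp
    also have "\<dots> \<le> norm u * B" using B(2) norm_bounded by (rule mult_right_mono[rotated])
    finally show ?thesis by (simp add: mult.commute)
  qed
  have ev: "bounded_linear (\<lambda>u :: 'g \<Rightarrow>\<^sub>C 'b. l (u (h m)))" for m
    using ev_le[of _ m]
    by (intro bounded_linear_intro[where K = B])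
      (auto simp: plus_bcontfun.rep_eq scaleR_bcontfun.rep_eq linear_simps[OF l] mult.commute)
  obtain F where F: "\<And>V. \<lbrakk>openin weak_topology V; F \<in> V\<rbrakk> \<Longrightarrow> \<exists>\<^sub>F n in sequentially. T n \<in> V"
  proof (rule compactin_sequence_cluster_point[where u = T])
    show "compactin weak_topology (weak_topology closure_of range (\<lambda>g. left_translate g f))"
      using wap by (simp add: weakly_almost_periodic_def)
    have "topspace weak_topology = (UNIV :: ('g \<Rightarrow>\<^sub>C 'b) set)"
      by (simp add: weak_topology_def topspace_pullback_topology)
    then show "T n \<in> weak_topology closure_of range (\<lambda>g. left_translate g f)" for n
      using closure_of_subset[of "range (\<lambda>g. left_translate g f)" weak_topology]
      by (auto simp: T_def)
  qed blast
  have weak: "\<exists>\<^sub>F n in sequentially. \<bar>\<phi> (T n) - \<phi> F\<bar> < e" if "e > 0" for \<phi> :: "('g \<Rightarrow>\<^sub>C 'b) \<Rightarrow>\<^sub>L real" and e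
    using F[OF openin_weak_topology_blinfun[of \<phi> "\<phi> F" e]] that by simp
  obtain \<phi> :: "('g \<Rightarrow>\<^sub>C 'b) \<Rightarrow>\<^sub>L real"
    where \<phi>: "\<And>(u :: 'g \<Rightarrow>\<^sub>C 'b) e. e > 0 \<Longrightarrow> \<exists>\<^sub>F m in sequentially. \<bar>l (apply_bcontfun u (h m)) - blinfun_apply \<phi> u\<bar> < e"
    by (rule bounded_functionals_cluster[where \<psi> = "\<lambda>m u. l (apply_bcontfun u (h m))", OF ev ev_le]) blast
  have "s m = l (F (h m))" for m
  proof (rule LIMSEQ_eq_cluster_value)
    show "(\<lambda>n. l (T n (h m))) \<longlonglongrightarrow> s m" using s(1) by (simp add: T)
    show "\<exists>\<^sub>F n in sequentially. \<bar>l (T n (h m)) - l (F (h m))\<bar> < e" if "e > 0" for e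
      using weak[OF that, of "Blinfun (\<lambda>u. l (apply_bcontfun u (h m)))"] by (simp add: bounded_linear_Blinfun_apply ev)
  qed
  then have "S = \<phi> F"
    using \<phi>[of _ F] by (intro LIMSEQ_eq_cluster_value[OF s(2)]) simp
  have "r n = \<phi> (T n)" for n
    using r(1) \<phi>[of _ "T n"] by (intro LIMSEQ_eq_cluster_value[of "\<lambda>m. l (f (g n + h m))"]) (simp_all add: T)
  then have "R = \<phi> F"
    using weak[of _ \<phi>] by (intro LIMSEQ_eq_cluster_value[OF r(2)]) simp
  with \<open>S = \<phi> F\<close> show "R = S" by simp
qed

text \<open>The diagonal argument, in the form of sequential compactness of a countable power of an interval.\<close>
lemma bounded_array_convergent_subsequence:
  fixes c :: "nat \<Rightarrow> nat \<Rightarrow> real"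
  assumes "\<And>i n. \<bar>c i n\<bar> \<le> M"
  obtains \<rho> :: "nat \<Rightarrow> nat" and l where "strict_mono \<rho>" "\<And>i. (\<lambda>n. c i (\<rho> n)) \<longlonglongrightarrow> l i"
proof -
  let ?K = "Pi\<^sub>E UNIV (\<lambda>_::nat. {-M..M})"
  have "compactin (product_topology (\<lambda>_::nat. euclideanreal) UNIV) ?K"
    by (simp add: compactin_PiE)
  then have "compact ?K"
    by (simp add: euclidean_product_topology)
  then have "seq_compact ?K"
    by (rule compact_imp_seq_compact)
  moreover have "\<forall>n. (\<lambda>i. c i n) \<in> ?K"
    using assms by (auto simp: PiE_iff abs_le_iff minus_le_iff)
  ultimately obtain l and \<rho> :: "nat \<Rightarrow> nat"
    where \<rho>: "strict_mono \<rho>" and l: "((\<lambda>n i. c i n) \<circ> \<rho>) \<longlonglongrightarrow> l"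
    unfolding seq_compact_def by metis
  have "(\<lambda>n. c i (\<rho> n)) \<longlonglongrightarrow> l i" for i
    using continuous_on_tendsto_compose[OF continuous_on_product_coordinates l, of i]
    by (simp add: o_def)
  with \<rho> show ?thesis using that by blast
qed

section \<open>Functions with the double limit property\<close>

text \<open>Weak almost periodicity is defined through left translates.  The properties collected here follow
  from it and are visibly symmetric under inversion of the group, so that left uniform continuity also
  yields right uniform continuity.\<close>
locale grothendieck_function =
  fixes f :: "'g::topological_group_add \<Rightarrow> real" and M :: real
  assumes cont: "continuous_on UNIV f" and bound: "\<bar>f x\<bar> \<le> M" and dl: "double_limit f"
begin

lemma double_limitD:
  assumes "\<And>n. (\<lambda>m. f (g n + h m)) \<longlonglongrightarrow> r n" "r \<longlonglongrightarrow> R"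
    and "\<And>m. (\<lambda>n. f (g n + h m)) \<longlonglongrightarrow> s m" "s \<longlonglongrightarrow> S"
  shows "R = S"
  using dl assms unfolding double_limit_def by blast

lemma LIMSEQ_bound:
  assumes "(\<lambda>n. f (x n)) \<longlonglongrightarrow> l"
  shows "\<bar>l\<bar> \<le> M"
  using tendsto_rabs[OF assms] by (rule LIMSEQ_le_const2) (use bound in auto)

lemma reflect: "grothendieck_function (\<lambda>x. f (- x)) M"
proof
  show "continuous_on UNIV (\<lambda>x. f (- x))"
    by (intro continuous_on_compose2[OF cont] continuous_intros) auto
  show "\<bar>f (- x)\<bar> \<le> M" for x by (rule bound)
  show "double_limit (\<lambda>x. f (- x))"
    unfolding double_limit_def
  proof (intro allI impI, elim conjE)
    fix g h :: "nat \<Rightarrow> 'g" and r s R S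
    assume "\<forall>n. (\<lambda>m. f (- (g n + h m))) \<longlonglongrightarrow> r n" "r \<longlonglongrightarrow> R"
      "\<forall>m. (\<lambda>n. f (- (g n + h m))) \<longlonglongrightarrow> s m" "s \<longlonglongrightarrow> S"
    then show "R = S"
      using double_limitD[of "\<lambda>m. - h m" "\<lambda>n. - g n" s S r R] by (simp add: minus_add)
  qed
qed

lemma translate: "grothendieck_function (\<lambda>x. f (g + x)) M"
proof
  show "continuous_on UNIV (\<lambda>x. f (g + x))"
    by (intro continuous_on_compose2[OF cont] continuous_intros) auto
  show "\<bar>f (g + x)\<bar> \<le> M" for x by (rule bound)
  show "double_limit (\<lambda>x. f (g + x))"
    unfolding double_limit_def
  proof (intro allI impI, elim conjE)
    fix k h :: "nat \<Rightarrow> 'g" and r s R S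
    assume "\<forall>n. (\<lambda>m. f (g + (k n + h m))) \<longlonglongrightarrow> r n" "r \<longlonglongrightarrow> R"
      "\<forall>m. (\<lambda>n. f (g + (k n + h m))) \<longlonglongrightarrow> s m" "s \<longlonglongrightarrow> S"
    then show "R = S"
      using double_limitD[of "\<lambda>n. g + k n" h r R s S] by (simp add: add.assoc)
  qed
qed

text \<open>An array that is nearly \<open>\<alpha>\<close> below the diagonal and nearly \<open>\<beta>\<close> above it has, along
  subsequences, one iterated limit near \<open>\<alpha>\<close> and the other near \<open>\<beta>\<close>.\<close>
lemma order_gap:
  fixes g h :: "nat \<Rightarrow> 'g"
  assumes below: "\<And>n m. m < n \<Longrightarrow> \<bar>f (g n + h m) - \<alpha>\<bar> \<le> p"
    and above: "\<And>n m. n < m \<Longrightarrow> \<bar>f (g n + h m) - \<beta>\<bar> \<le> q"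
  shows "\<bar>\<alpha> - \<beta>\<bar> \<le> p + q"
proof -
  obtain \<rho> r where \<rho>: "strict_mono \<rho>" and r: "\<And>n. (\<lambda>m. f (g n + h (\<rho> m))) \<longlonglongrightarrow> r n"
    using bounded_array_convergent_subsequence[of "\<lambda>n m. f (g n + h m)" M, OF bound] by metis
  have r_bound: "\<bar>r n\<bar> \<le> M" for n using LIMSEQ_bound[OF r] .
  define c where "c i n = (case i of 0 \<Rightarrow> r n | Suc m \<Rightarrow> f (g n + h (\<rho> m)))" for i n
  have "\<bar>c i n\<bar> \<le> M" for i n
    by (cases i) (simp_all add: c_def bound r_bound)
  then obtain \<sigma> l where \<sigma>: "strict_mono \<sigma>" and l: "\<And>i. (\<lambda>n. c i (\<sigma> n)) \<longlonglongrightarrow> l i"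
    using bounded_array_convergent_subsequence[of c M] by blast
  have R: "(\<lambda>n. r (\<sigma> n)) \<longlonglongrightarrow> l 0" using l[of 0] by (simp add: c_def)
  have s: "(\<lambda>n. f (g (\<sigma> n) + h (\<rho> m))) \<longlonglongrightarrow> l (Suc m)" for m
    using l[of "Suc m"] by (simp add: c_def)
  obtain \<tau> S where \<tau>: "strict_mono (\<tau> :: nat \<Rightarrow> nat)" and S: "(\<lambda>m. l (Suc (\<tau> m))) \<longlonglongrightarrow> S"
    using bounded_array_convergent_subsequence[of "\<lambda>_ m. l (Suc m)" M, OF LIMSEQ_bound[OF s]] by metis
  have eq: "l 0 = S"
  proof (rule double_limitD[OF _ R _ S])
    show "(\<lambda>m. f (g (\<sigma> n) + h (\<rho> (\<tau> m)))) \<longlonglongrightarrow> r (\<sigma> n)" for n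
      using LIMSEQ_subseq_LIMSEQ[OF r \<tau>] by (simp add: o_def)
  qed (rule s)
  have "\<bar>r n - \<beta>\<bar> \<le> q" for n
  proof (rule LIMSEQ_le_const2)
    show "(\<lambda>m. \<bar>f (g n + h (\<rho> m)) - \<beta>\<bar>) \<longlonglongrightarrow> \<bar>r n - \<beta>\<bar>"
      by (intro tendsto_intros r)
    have "n < \<rho> m" if "m \<ge> Suc n" for m
      using seq_suble[OF \<rho>, of m] that by simp
    then show "\<exists>N. \<forall>m\<ge>N. \<bar>f (g n + h (\<rho> m)) - \<beta>\<bar> \<le> q"
      by (intro exI[of _ "Suc n"] allI impI above)
  qed
  moreover have "(\<lambda>n. \<bar>r (\<sigma> n) - \<beta>\<bar>) \<longlonglongrightarrow> \<bar>l 0 - \<beta>\<bar>"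
    by (intro tendsto_intros R)
  ultimately have 1: "\<bar>l 0 - \<beta>\<bar> \<le> q"
    by (intro LIMSEQ_le_const2) auto
  have "\<bar>l (Suc m) - \<alpha>\<bar> \<le> p" for m
  proof (rule LIMSEQ_le_const2)
    show "(\<lambda>n. \<bar>f (g (\<sigma> n) + h (\<rho> m)) - \<alpha>\<bar>) \<longlonglongrightarrow> \<bar>l (Suc m) - \<alpha>\<bar>"
      by (intro tendsto_intros s)
    have "\<rho> m < \<sigma> n" if "n \<ge> Suc (\<rho> m)" for n
      using seq_suble[OF \<sigma>, of n] that by simp
    then show "\<exists>N. \<forall>n\<ge>N. \<bar>f (g (\<sigma> n) + h (\<rho> m)) - \<alpha>\<bar> \<le> p"
      by (intro exI[of _ "Suc (\<rho> m)"] allI impI below)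
  qed
  moreover have "(\<lambda>m. \<bar>l (Suc (\<tau> m)) - \<alpha>\<bar>) \<longlonglongrightarrow> \<bar>S - \<alpha>\<bar>"
    by (intro tendsto_intros S)
  ultimately have "\<bar>S - \<alpha>\<bar> \<le> p"
    by (intro LIMSEQ_le_const2) auto
  with 1 eq show ?thesis by linarith
qed

text \<open>The sequences \<open>x\<close> and \<open>y\<close> become indistinguishable for each \<open>g i\<close>, so the iterated limits
  along them that take \<open>n\<close> first are equal.  Interchanging the limits shows that \<open>a\<close> and \<open>b\<close>
  cannot stay apart.\<close>
lemma merging_pairs:
  assumes merge: "\<And>i. (\<lambda>n. f (g i + x n) - f (g i + y n)) \<longlonglongrightarrow> 0"
    and a: "\<And>n. (\<lambda>i. f (g i + x n)) \<longlonglongrightarrow> a n" and b: "\<And>n. (\<lambda>i. f (g i + y n)) \<longlonglongrightarrow> b n"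
    and "e > 0"
  shows "\<exists>n::nat. \<bar>a n - b n\<bar> < e"
proof (rule ccontr)
  assume "\<not> ?thesis"
  then have far: "\<bar>a n - b n\<bar> \<ge> e" for n by (simp add: not_less)
  define c where "c i n = (if i = 0 then a n else if i = 1 then b n else f (g (i - 2) + x n))"
    for i n
  have "\<bar>c i n\<bar> \<le> M" for i n
    using bound LIMSEQ_bound[OF a] LIMSEQ_bound[OF b] by (auto simp: c_def)
  then obtain \<rho> l where \<rho>: "strict_mono \<rho>" and l: "\<And>i. (\<lambda>n. c i (\<rho> n)) \<longlonglongrightarrow> l i"
    using bounded_array_convergent_subsequence[of c M] by blast
  have a': "(\<lambda>n. a (\<rho> n)) \<longlonglongrightarrow> l 0" and b': "(\<lambda>n. b (\<rho> n)) \<longlonglongrightarrow> l 1"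
    using l[of 0] l[of 1] by (simp_all add: c_def)
  have x: "(\<lambda>n. f (g i + x (\<rho> n))) \<longlonglongrightarrow> l (Suc (Suc i))" for i
    using l[of "Suc (Suc i)"] by (simp add: c_def)
  have y: "(\<lambda>n. f (g i + y (\<rho> n))) \<longlonglongrightarrow> l (Suc (Suc i))" for i
    using tendsto_diff[OF x LIMSEQ_subseq_LIMSEQ[OF merge \<rho>], of i i] by (simp add: o_def)
  obtain \<sigma> R where \<sigma>: "strict_mono (\<sigma> :: nat \<Rightarrow> nat)" and R: "(\<lambda>i. l (Suc (Suc (\<sigma> i)))) \<longlonglongrightarrow> R"
    using bounded_array_convergent_subsequence[of "\<lambda>_ i. l (Suc (Suc i))" M] LIMSEQ_bound[OF x] by blast
  have "R = l 0"
    using LIMSEQ_subseq_LIMSEQ[OF a \<sigma>]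
    by (intro double_limitD[OF x R _ a']) (simp add: o_def)
  moreover have "R = l 1"
    using LIMSEQ_subseq_LIMSEQ[OF b \<sigma>]
    by (intro double_limitD[OF y R _ b']) (simp add: o_def)
  ultimately have "(\<lambda>n. \<bar>a (\<rho> n) - b (\<rho> n)\<bar>) \<longlonglongrightarrow> 0"
    using tendsto_rabs[OF tendsto_diff[OF a' b']] by simp
  then have "e \<le> 0"
    by (rule LIMSEQ_le_const) (use far in auto)
  with \<open>e > 0\<close> show False by simp
qed

text \<open>The translates by \<open>S\<close> define a bounded map to the finite-dimensional space of functions on
  \<open>S\<close>, and bounded sets there are totally bounded.\<close>
lemma finite_net:
  assumes S: "finite S" and "e > 0"
  obtains X where "finite X" "\<And>x. \<exists>x0\<in>X. \<forall>s\<in>S. \<bar>f (s + x) - f (s + x0)\<bar> < e"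
proof -
  define \<kappa> where "\<kappa> x = restrict (\<lambda>s. \<lfloor>f (s + x) / e\<rfloor>) S" for x
  have "\<kappa> x \<in> Pi\<^sub>E S (\<lambda>_. {\<lfloor>- M / e\<rfloor>..\<lfloor>M / e\<rfloor>})" for x
    using \<open>e > 0\<close> abs_le_D1[OF bound] abs_le_D2[OF bound] unfolding \<kappa>_def
    by (intro restrict_PiE_iff[THEN iffD2] ballI atLeastAtMost_iff[THEN iffD2] conjI floor_mono
        divide_right_mono) (auto simp: minus_le_iff)
  moreover have "finite (Pi\<^sub>E S (\<lambda>_. {\<lfloor>- M / e\<rfloor>..\<lfloor>M / e\<rfloor>}))"
    using S by (intro finite_PiE) auto
  ultimately have fin: "finite (range \<kappa>)"
    by (meson finite_subset image_subsetI)
  define X where "X = inv \<kappa> ` range \<kappa>"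
  have "\<exists>x0\<in>X. \<forall>s\<in>S. \<bar>f (s + x) - f (s + x0)\<bar> < e" for x
  proof (intro bexI ballI)
    show "inv \<kappa> (\<kappa> x) \<in> X" by (simp add: X_def)
    fix s assume "s \<in> S"
    have "\<kappa> (inv \<kappa> (\<kappa> x)) s = \<kappa> x s" by (simp add: f_inv_into_f)
    then have "\<lfloor>f (s + inv \<kappa> (\<kappa> x)) / e\<rfloor> = \<lfloor>f (s + x) / e\<rfloor>"
      using \<open>s \<in> S\<close> by (simp add: \<kappa>_def)
    then have "\<bar>f (s + x) / e - f (s + inv \<kappa> (\<kappa> x)) / e\<bar> < 1" by linarith
    then show "\<bar>f (s + x) - f (s + inv \<kappa> (\<kappa> x))\<bar> < e"
      using \<open>e > 0\<close> by (simp add: diff_divide_distrib[symmetric] abs_divide)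
  qed
  moreover have "finite X" using fin by (simp add: X_def)
  ultimately show ?thesis using that by blast
qed

end

section \<open>Isometries fixing a finite set\<close>

lemma app_iso_add [simp]: "app_iso (g + h) x = app_iso g (app_iso h x)"
  by (simp add: plus_isometry.rep_eq)

lemma app_iso_zero [simp]: "app_iso 0 x = x"
  by (simp add: zero_isometry.rep_eq)

lemma app_iso_minus_cancel [simp]:
  "app_iso (- g) (app_iso g x) = x" "app_iso g (app_iso (- g) x) = x"
  using app_iso_add[of "- g" g x] app_iso_add[of g "- g" x] by (simp_all del: app_iso_add)

lemma dist_app_iso [simp]: "dist (app_iso g x) (app_iso g y) = dist x y"
  using app_iso[of g] by (simp add: global_isometry_def)

lemma dist_app_iso_left: "dist (app_iso g x) y = dist x (app_iso (- g) y)"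
  by (metis app_iso_minus_cancel(2) dist_app_iso)

definition fixator :: "'a set \<Rightarrow> 'a::metric_space isometry set" where
  "fixator A = {u. \<forall>a\<in>A. app_iso u a = a}"

lemma fixatorD: "u \<in> fixator A \<Longrightarrow> a \<in> A \<Longrightarrow> app_iso u a = a"
  by (simp add: fixator_def)

lemma fixator_antimono: "A \<subseteq> B \<Longrightarrow> fixator B \<subseteq> fixator A"
  by (auto simp: fixator_def)

lemma zero_in_fixator [simp]: "0 \<in> fixator A"
  by (simp add: fixator_def)

lemma minus_in_fixator: "u \<in> fixator A \<Longrightarrow> - u \<in> fixator A"
  unfolding fixator_def by (auto dest!: bspec) (metis app_iso_minus_cancel(1))

lemma isometry_neighbourhood:
  fixes g :: "'a::metric_space isometry"
  assumes "open S" "g \<in> S"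
  obtains A \<delta> where "finite A" "\<delta> > 0"
    "\<And>h. (\<And>a. a \<in> A \<Longrightarrow> dist (app_iso h a) (app_iso g a) < \<delta>) \<Longrightarrow> h \<in> S"
proof -
  obtain T where T: "open T" "S = app_iso -` T"
    using assms by (auto simp: open_isometry_def)
  obtain X where X: "app_iso g \<in> Pi\<^sub>E UNIV X" "\<And>i. open (X i)" "finite {i. X i \<noteq> UNIV}"
      "Pi\<^sub>E UNIV X \<subseteq> T"
    using product_topology_open_contains_basis[of "\<lambda>_. euclidean" UNIV T "app_iso g"] T assms
    by (auto simp: open_fun_def)
  define A where "A = {i. X i \<noteq> UNIV}"
  have "\<exists>d>0. \<forall>y. dist y (app_iso g a) < d \<longrightarrow> y \<in> X a" for a
    using X(1,2) by (auto simp: PiE_iff open_dist)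
  then obtain d where d: "\<And>a. d a > 0" "\<And>a y. dist y (app_iso g a) < d a \<Longrightarrow> y \<in> X a"
    by metis
  show ?thesis
  proof
    show "finite A" using X(3) by (simp add: A_def)
    then show "Min (insert 1 (d ` A)) > 0" using d(1) by simp
    fix h assume h: "\<And>a. a \<in> A \<Longrightarrow> dist (app_iso h a) (app_iso g a) < Min (insert 1 (d ` A))"
    have "app_iso h a \<in> X a" for a
    proof (cases "a \<in> A")
      case True
      with h[OF True] \<open>finite A\<close> show ?thesis by (intro d(2)) auto
    qed (simp add: A_def)
    then show "h \<in> S" using X(4) T(2) by (auto simp: PiE_iff)
  qed
qed

lemma open_contains_fixator_coset:
  fixes g :: "'a::metric_space isometry"
  assumes "open S" "g \<in> S"
  obtains A where "finite A" "\<And>u. u \<in> fixator A \<Longrightarrow> g + u \<in> S"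
proof -
  obtain A \<delta> where "finite A" "\<delta> > 0"
    and A: "\<And>h. (\<And>a. a \<in> A \<Longrightarrow> dist (app_iso h a) (app_iso g a) < \<delta>) \<Longrightarrow> h \<in> S"
    using isometry_neighbourhood[OF assms] by blast
  then show ?thesis
    by (intro that[of A]) (auto intro!: A simp: fixatorD)
qed

text \<open>Convergence of the inverses is what makes the limit surjective; a pointwise limit of bijective
  isometries is in general only an isometric embedding.\<close>
lemma isometry_limit_exists:
  fixes v :: "nat \<Rightarrow> 'a::metric_space isometry"
  assumes complete: "complete (UNIV :: 'a set)" and dense: "closure D = (UNIV :: 'a set)"
    and conv: "\<And>d. d \<in> D \<Longrightarrow> convergent (\<lambda>n. app_iso (v n) d)"
      "\<And>d. d \<in> D \<Longrightarrow> convergent (\<lambda>n. app_iso (- v n) d)"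
  obtains w where "v \<longlonglongrightarrow> w"
proof -
  have lim: "\<exists>y. (\<lambda>n. app_iso (u n) x) \<longlonglongrightarrow> y"
    if u: "\<And>d. d \<in> D \<Longrightarrow> convergent (\<lambda>n. app_iso (u n) d)" for u :: "nat \<Rightarrow> 'a isometry" and x
  proof -
    have "Cauchy (\<lambda>n. app_iso (u n) x)"
    proof (rule metric_CauchyI)
      fix e :: real assume "e > 0"
      have "x \<in> closure D" using dense by simp
      then obtain d where d: "d \<in> D" "dist d x < e / 3"
        using \<open>e > 0\<close> by (metis closure_approachable divide_pos_pos zero_less_numeral)
      have "Cauchy (\<lambda>n. app_iso (u n) d)" using u[OF d(1)] by (rule convergent_Cauchy)
      then obtain N where N: "\<And>m n. m \<ge> N \<Longrightarrow> n \<ge> N \<Longrightarrow> dist (app_iso (u m) d) (app_iso (u n) d) < e / 3"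
        using \<open>e > 0\<close> by (metis metric_CauchyD divide_pos_pos zero_less_numeral)
      have "dist (app_iso (u m) x) (app_iso (u n) x) < e" if "m \<ge> N" "n \<ge> N" for m n
      proof -
        have "dist (app_iso (u m) x) (app_iso (u n) x) \<le>
            dist (app_iso (u m) x) (app_iso (u m) d) + dist (app_iso (u m) d) (app_iso (u n) d)
            + dist (app_iso (u n) d) (app_iso (u n) x)"
          by (meson add_mono_thms_linordered_semiring(3) dist_triangle order_trans)
        also have "\<dots> < e" using d(2) N[OF that] by (simp add: dist_commute)
        finally show ?thesis .
      qed
      then show "\<exists>N. \<forall>m\<ge>N. \<forall>n\<ge>N. dist (app_iso (u m) x) (app_iso (u n) x) < e" by blast
    qed
    then show ?thesis using complete by (auto simp: complete_def)
  qed
  obtain V where V: "\<And>x. (\<lambda>n. app_iso (v n) x) \<longlonglongrightarrow> V x" using lim[OF conv(1)] by metis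
  obtain W where W: "\<And>x. (\<lambda>n. app_iso (- v n) x) \<longlonglongrightarrow> W x"
    using lim[of "\<lambda>n. - v n"] conv(2) by metis
  have "dist (V x) (V y) = dist x y" for x y
    using tendsto_dist[OF V V, of x y] by (simp add: LIMSEQ_const_iff)
  moreover have "V (W x) = x" for x
  proof -
    have "(\<lambda>n. dist (app_iso (v n) (W x)) x) \<longlonglongrightarrow> 0"
      using W[of x] by (subst dist_app_iso_left) (simp add: tendsto_dist_iff[of _ "W x"] dist_commute)
    then show ?thesis
      using V[of "W x"] LIMSEQ_unique tendsto_dist_iff by blast
  qed
  ultimately have "global_isometry V"
    unfolding global_isometry_def bij_def inj_def surj_def by (metis dist_eq_0_iff)
  then have "v \<longlonglongrightarrow> Abs_isometry V"
    using V by (simp add: tendsto_isometry_iff Abs_isometry_inverse)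
  then show ?thesis by (rule that)
qed

section \<open>Uniform continuity\<close>

text \<open>The inductive step of a Namioka-type argument.  Suppose that the functions \<open>x \<mapsto> f (w + x)\<close> with
  \<open>w\<close> near \<open>v\<close> separate no two points that the translates of \<open>f\<close> by \<open>S\<close> leave unseparated.  Then
  each of them is determined, up to a small error, by its values on a finite net, and these vary
  little with \<open>w\<close> by continuity.  This makes it uniformly close to \<open>x \<mapsto> f (v + x)\<close>, which the assumption \<open>bad\<close> excludes.\<close>
lemma separated_pair_exists:
  fixes f :: "'a::metric_space isometry \<Rightarrow> real"
  assumes gf: "grothendieck_function f M" and "e > 0" "\<eta> > 0" and fin: "finite A" "finite S"
    and bad: "\<And>B. finite B \<Longrightarrow> \<exists>u\<in>fixator B. \<exists>x. \<bar>f (u + x) - f x\<bar> > e"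
  shows "\<exists>u\<in>fixator A. \<exists>x y. (\<forall>s\<in>S. \<bar>f (s + x) - f (s + y)\<bar> < \<eta>) \<and> \<bar>f (v + u + x) - f (v + u + y)\<bar> > e / 4"
proof (rule ccontr)
  interpret grothendieck_function f M by (rule gf)
  assume "\<not> ?thesis"
  then have control: "\<bar>f (v + u + x) - f (v + u + y)\<bar> \<le> e / 4"
    if "u \<in> fixator A" "\<forall>s\<in>S. \<bar>f (s + x) - f (s + y)\<bar> < \<eta>" for u x y
    using that by (meson not_le)
  obtain X where X: "finite X" "\<And>x. \<exists>x0\<in>X. \<forall>s\<in>S. \<bar>f (s + x) - f (s + x0)\<bar> < \<eta>"
    using finite_net[OF fin(2) \<open>\<eta> > 0\<close>] by blast
  define U where "U = (\<Inter>x\<in>X. {w. \<bar>f (w + x) - f (v + x)\<bar> < e / 4})"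
  have "open {w. \<bar>f (w + x) - f (v + x)\<bar> < e / 4}" for x
    by (intro open_Collect_less continuous_on_compose2[OF cont] continuous_intros) auto
  then have "open U"
    unfolding U_def using X(1) by (intro open_INT) auto
  moreover have "v \<in> U"
    using \<open>e > 0\<close> by (simp add: U_def)
  ultimately obtain A' where A': "finite A'" "\<And>u. u \<in> fixator A' \<Longrightarrow> v + u \<in> U"
    by (rule open_contains_fixator_coset) blast
  \<comment> \<open>Stabilisers are conjugated by \<open>v\<close>: an isometry \<open>w\<close> that fixes the image of a set under \<open>v\<close>
    gives an isometry \<open>u\<close> with \<open>v + u = w + v\<close> that fixes the set itself.\<close>
  have "finite (app_iso v ` (A \<union> A'))" using fin A'(1) by simp
  from bad[OF this] obtain w y where w: "w \<in> fixator (app_iso v ` (A \<union> A'))" "\<bar>f (w + y) - f y\<bar> > e"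
    by blast
  define u where "u = - v + (w + v)"
  have u: "u \<in> fixator A" "u \<in> fixator A'"
    using w(1) by (auto simp: u_def fixator_def)
  obtain x0 where x0: "x0 \<in> X" "\<forall>s\<in>S. \<bar>f (s + (- v + y)) - f (s + x0)\<bar> < \<eta>"
    using X(2) by blast
  have "v + u + (- v + y) = w + y" "v + 0 + (- v + y) = y"
    by (simp_all add: u_def add.assoc)
  then have "\<bar>f (w + y) - f (v + u + x0)\<bar> \<le> e / 4" "\<bar>f y - f (v + 0 + x0)\<bar> \<le> e / 4"
    using control[OF u(1) x0(2)] control[OF zero_in_fixator x0(2)] by simp_all
  moreover have "\<bar>f (v + u + x0) - f (v + x0)\<bar> < e / 4"
    using A'(2)[OF u(2)] x0(1) by (simp add: U_def)
  ultimately show False using w(2) unfolding add_0_right by linarith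
qed

text \<open>If this fails, iterating \<open>separated_pair_exists\<close> produces shrinking cosets \<open>v n + fixator (A n)\<close>
  and pairs \<open>x n\<close>, \<open>y n\<close> which are nearly indistinguishable by the earlier \<open>v i\<close> but are separated by
  every element of the next coset.  Completeness gives a common point \<open>w\<close> of all the cosets.  It is
  the limit of the \<open>v i\<close> and separates every pair, which contradicts \<open>merging_pairs\<close>.\<close>
lemma nearly_fixator_invariant_left:
  fixes f :: "'a::metric_space isometry \<Rightarrow> real"
  assumes complete: "complete (UNIV :: 'a set)"
    and separable: "separable_space (euclidean :: 'a topology)"
    and gf: "grothendieck_function f M" and "e > 0"
  obtains A where "finite A" "\<And>u x. u \<in> fixator A \<Longrightarrow> \<bar>f (u + x) - f x\<bar> \<le> e"
proof -
  interpret grothendieck_function f M by (rule gf)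
  have "\<exists>A. finite A \<and> (\<forall>u\<in>fixator A. \<forall>x. \<bar>f (u + x) - f x\<bar> \<le> e)"
  proof (rule ccontr)
    assume "\<not> ?thesis"
    then have bad: "\<exists>u\<in>fixator B. \<exists>x. \<bar>f (u + x) - f x\<bar> > e" if "finite B" for B
      using that by (meson not_le)
    obtain D :: "'a set" where D: "countable D" "closure D = UNIV"
      using separable unfolding separable_space_def by auto
    then have "D \<noteq> {}" by force
    with D(1) obtain d :: "nat \<Rightarrow> 'a" where d: "range d = D"
      by (metis range_from_nat_into)
    \<comment> \<open>In a state \<open>(v, A, S)\<close> the current coset is \<open>v + fixator A\<close>, and \<open>S\<close> collects the
      centres used so far.  Putting \<open>d n\<close> and its preimage into \<open>A'\<close> fixes from then on the values
      of the centres and of their inverses at \<open>d n\<close>; this makes the centres converge.\<close>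
    let ?P = "\<lambda>(n::nat) (v, A :: 'a set, S). finite A \<and> finite S \<and> (v :: 'a isometry) \<in> S"
    let ?Q = "\<lambda>n (v, A, S) (v', A', S'). (\<exists>u\<in>fixator A. v' = v + u) \<and> A \<subseteq> A' \<and> S \<subseteq> S' \<and>
        d n \<in> A' \<and> app_iso (- v') (d n) \<in> A' \<and>
        (\<exists>x y. (\<forall>s\<in>S. \<bar>f (s + x) - f (s + y)\<bar> < 1 / Suc n) \<and>
          (\<forall>u\<in>fixator A'. \<bar>f (v' + u + x) - f (v' + u + y)\<bar> > e / 4))"
    have "\<exists>st. ?P 0 st"
      by (intro exI[of _ "(0, {}, {0})"]) simp
    moreover have "\<exists>st'. ?P (Suc n) st' \<and> ?Q n st st'" if "?P n st" for st n
    proof -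
      obtain v A S where st: "st = (v, A, S)" by (cases st)
      have fin: "finite A" "finite S" "v \<in> S" using that by (simp_all add: st)
      obtain u x y where u: "u \<in> fixator A" and S: "\<forall>s\<in>S. \<bar>f (s + x) - f (s + y)\<bar> < 1 / Suc n"
        and far: "\<bar>f (v + u + x) - f (v + u + y)\<bar> > e / 4"
        using separated_pair_exists[OF gf \<open>e > 0\<close> _ fin(1,2) bad, of "1 / Suc n" v] by auto
      have "open {w. \<bar>f (w + x) - f (w + y)\<bar> > e / 4}"
        by (intro open_Collect_less continuous_on_compose2[OF cont] continuous_intros) auto
      moreover have "v + u \<in> {w. \<bar>f (w + x) - f (w + y)\<bar> > e / 4}"
        using far by simp
      ultimately obtain A' where A': "finite A'"
        "\<And>u'. u' \<in> fixator A' \<Longrightarrow> v + u + u' \<in> {w. \<bar>f (w + x) - f (w + y)\<bar> > e / 4}"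
        by (rule open_contains_fixator_coset) blast
      let ?A = "A \<union> A' \<union> {d n, app_iso (- (v + u)) (d n)}"
      have "fixator ?A \<subseteq> fixator A'" by (intro fixator_antimono) auto
      then have "\<forall>u'\<in>fixator ?A. \<bar>f (v + u + u' + x) - f (v + u + u' + y)\<bar> > e / 4"
        using A'(2) by auto
      with u S show ?thesis
        by (intro exI[of _ "(v + u, ?A, insert (v + u) S)"]) (use fin A'(1) in \<open>auto simp: st\<close>)
    qed
    ultimately obtain st where st: "\<And>n. ?P n (st n) \<and> ?Q n (st n) (st (Suc n))"
      using dependent_nat_choice[of ?P ?Q] by blast
    define v A S where "v n = fst (st n)" and "A n = fst (snd (st n))" and "S n = snd (snd (st n))" for n
    have st_eq: "st n = (v n, A n, S n)" for n by (simp add: v_def A_def S_def)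
    have vS: "v n \<in> S n"
      and step: "\<exists>u\<in>fixator (A n). v (Suc n) = v n + u"
      and A_Suc: "A n \<subseteq> A (Suc n)" and S_Suc: "S n \<subseteq> S (Suc n)"
      and dA: "d n \<in> A (Suc n)" and dA': "app_iso (- v (Suc n)) (d n) \<in> A (Suc n)"
      and "\<exists>x y. (\<forall>s\<in>S n. \<bar>f (s + x) - f (s + y)\<bar> < 1 / Suc n) \<and>
          (\<forall>u\<in>fixator (A (Suc n)). \<bar>f (v (Suc n) + u + x) - f (v (Suc n) + u + y)\<bar> > e / 4)" for n
      using st[of n] unfolding st_eq by auto
    then obtain x y where xy: "\<And>n s. s \<in> S n \<Longrightarrow> \<bar>f (s + x n) - f (s + y n)\<bar> < 1 / Suc n"
      "\<And>n u. u \<in> fixator (A (Suc n)) \<Longrightarrow> \<bar>f (v (Suc n) + u + x n) - f (v (Suc n) + u + y n)\<bar> > e / 4"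
      by metis
    have S_mono: "v i \<in> S n" if "i \<le> n" for i n
      using lift_Suc_mono_le[of S, OF S_Suc that] vS by blast
    have settled: "app_iso (v m) a = app_iso (v n) a" if "n \<le> m" "a \<in> A n" for n m a
      using that(1)
    proof (induction m rule: dec_induct)
      case (step m)
      obtain u where "u \<in> fixator (A m)" "v (Suc m) = v m + u"
        using \<open>\<exists>u\<in>fixator (A m). v (Suc m) = v m + u\<close> by blast
      moreover have "a \<in> A m"
        using lift_Suc_mono_le[of A, OF A_Suc step.hyps(1)] that(2) by blast
      ultimately show ?case using step.IH by (simp add: fixatorD)
    qed simp
    obtain w where w: "v \<longlonglongrightarrow> w"
    proof (rule isometry_limit_exists[OF complete D(2)])
      fix z assume "z \<in> D"
      then obtain n where n: "z = d n" using d by blast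
      have "app_iso (v m) z = app_iso (v (Suc n)) z" if "m \<ge> Suc n" for m
        using settled[OF that dA] by (simp add: n)
      then have "(\<lambda>m. app_iso (v m) z) \<longlonglongrightarrow> app_iso (v (Suc n)) z"
        by (intro tendsto_eventually eventually_sequentiallyI)
      then show "convergent (\<lambda>m. app_iso (v m) z)" by (rule convergentI)
      have "app_iso (- v m) z = app_iso (- v (Suc n)) z" if "m \<ge> Suc n" for m
        using settled[OF that dA'] by (metis app_iso_minus_cancel n)
      then have "(\<lambda>m. app_iso (- v m) z) \<longlonglongrightarrow> app_iso (- v (Suc n)) z"
        by (intro tendsto_eventually eventually_sequentiallyI)
      then show "convergent (\<lambda>m. app_iso (- v m) z)" by (rule convergentI)
    qed blast
    have f_lim: "(\<lambda>i. f (v i + z)) \<longlonglongrightarrow> f (w + z)" for z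
      by (intro continuous_on_tendsto_compose[OF cont]) (auto intro!: tendsto_intros w)
    have merge: "(\<lambda>n. f (v i + x n) - f (v i + y n)) \<longlonglongrightarrow> 0" for i
    proof (rule Lim_null_comparison)
      show "(\<lambda>n. 1 / real (Suc n)) \<longlonglongrightarrow> 0"
        using LIMSEQ_inverse_real_of_nat by (simp add: inverse_eq_divide)
      show "\<forall>\<^sub>F n in sequentially. norm (f (v i + x n) - f (v i + y n)) \<le> 1 / real (Suc n)"
        using xy(1)[OF S_mono] by (intro eventually_sequentiallyI[of i]) (simp add: less_imp_le)
    qed
    obtain n where n: "\<bar>f (w + x n) - f (w + y n)\<bar> < e / 4"
      using merging_pairs[OF merge f_lim f_lim, of "e / 4"] \<open>e > 0\<close> by auto
    have "- v (Suc n) + w \<in> fixator (A (Suc n))"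
    proof -
      have "app_iso w a = app_iso (v (Suc n)) a" if "a \<in> A (Suc n)" for a
      proof (rule LIMSEQ_unique[OF tendsto_app_iso[OF w]])
        show "(\<lambda>m. app_iso (v m) a) \<longlonglongrightarrow> app_iso (v (Suc n)) a"
          using settled[OF _ that] by (intro tendsto_eventually eventually_sequentiallyI)
      qed
      then show ?thesis by (simp add: fixator_def)
    qed
    from xy(2)[OF this] have "\<bar>f (w + x n) - f (w + y n)\<bar> > e / 4"
      by (simp add: add.assoc[symmetric])
    with n show False by simp
  qed
  then show ?thesis using that by blast
qed

lemma nearly_fixator_biinvariant:
  fixes f :: "'a::metric_space isometry \<Rightarrow> real"
  assumes complete: "complete (UNIV :: 'a set)"
    and separable: "separable_space (euclidean :: 'a topology)"
    and gf: "grothendieck_function f M" and "e > 0"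
  obtains A where "finite A"
    "\<And>u v x. \<lbrakk>u \<in> fixator A; v \<in> fixator A\<rbrakk> \<Longrightarrow> \<bar>f (u + x + v) - f x\<bar> \<le> e"
proof -
  have "e / 2 > 0" using \<open>e > 0\<close> by simp
  from nearly_fixator_invariant_left[OF complete separable gf this]
  obtain A where A: "finite A" "\<And>u x. u \<in> fixator A \<Longrightarrow> \<bar>f (u + x) - f x\<bar> \<le> e / 2"
    by blast
  from nearly_fixator_invariant_left[OF complete separable grothendieck_function.reflect[OF gf] \<open>e / 2 > 0\<close>]
  obtain B where B: "finite B" "\<And>u x. u \<in> fixator B \<Longrightarrow> \<bar>f (- (u + x)) - f (- x)\<bar> \<le> e / 2"
    by blast
  show ?thesis
  proof (rule that)
    show "finite (A \<union> B)" using A(1) B(1) by simp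
    fix u v x assume "u \<in> fixator (A \<union> B)" "v \<in> fixator (A \<union> B)"
    then have "u \<in> fixator A" "- v \<in> fixator B"
      by (auto simp: fixator_def intro: minus_in_fixator[unfolded fixator_def, simplified, rule_format])
    then have "\<bar>f (u + (x + v)) - f (x + v)\<bar> \<le> e / 2" "\<bar>f (x + v) - f x\<bar> \<le> e / 2"
      using A(2) B(2)[of "- v" "- x"] by (auto simp: minus_add)
    then show "\<bar>f (u + x + v) - f x\<bar> \<le> e" unfolding add.assoc by linarith
  qed
qed

section \<open>Types of finite sets in the Urysohn space\<close>

lemma partial_isometry_extends:
  fixes A :: "'a::metric_space set"
  assumes U: "urysohn_space_1 TYPE('a)" and "finite A"
    and "\<forall>x\<in>A. \<forall>y\<in>A. dist (h x) (h y) = dist x y"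
  obtains g :: "'a isometry" where "\<And>x. x \<in> A \<Longrightarrow> app_iso g x = h x"
proof -
  have "\<exists>g. global_isometry g \<and> (\<forall>x\<in>A. g x = h x)"
    using U assms(2,3) unfolding urysohn_space_1_def by (elim conjE) blast
  then obtain g where g: "global_isometry g" "\<forall>x\<in>A. g x = h x" by blast
  then show ?thesis by (intro that[of "Abs_isometry g"]) (simp add: Abs_isometry_inverse)
qed

text \<open>The map that is the identity on \<open>A\<close> and sends \<open>k a\<close> to \<open>k' a\<close> is a partial isometry precisely
  because the matrices agree; \<open>u\<close> is an extension of it.\<close>
lemma same_matrix_imp_same_double_coset:
  fixes k k' :: "'a::metric_space isometry"
  assumes U: "urysohn_space_1 TYPE('a)" and A: "finite A"
    and eq: "\<And>a b. \<lbrakk>a \<in> A; b \<in> A\<rbrakk> \<Longrightarrow> dist (app_iso k a) b = dist (app_iso k' a) b"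
  obtains u v where "u \<in> fixator A" "v \<in> fixator A" "k' = u + k + v"
proof -
  \<comment> \<open>The sets \<open>A\<close> and \<open>k A\<close> may overlap.  Where \<open>k a\<close> lies in \<open>A\<close>, the matrix entry \<open>0\<close> shows that
    \<open>k' a = k a\<close>, so both clauses agree.\<close>
  define h where "h x = (if x \<in> A then x else app_iso k' (app_iso (- k) x))" for x
  have hk: "h (app_iso k a) = app_iso k' a" if "a \<in> A" for a
    using eq[OF that, of "app_iso k a"] by (auto simp: h_def)
  have hA: "h a = a" if "a \<in> A" for a using that by (simp add: h_def)
  have "finite (A \<union> app_iso k ` A)" using A by simp
  moreover have "\<forall>x\<in>A \<union> app_iso k ` A. \<forall>y\<in>A \<union> app_iso k ` A. dist (h x) (h y) = dist x y"
    using eq by (auto simp: hk hA) (metis dist_commute)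
  ultimately obtain u where u: "app_iso u x = h x" if "x \<in> A \<union> app_iso k ` A" for x
    by (rule partial_isometry_extends[OF U]) blast
  show ?thesis
  proof
    show "u \<in> fixator A" using u hA by (simp add: fixator_def)
    have "app_iso (- k) (app_iso (- u) (app_iso k' a)) = a" if "a \<in> A" for a
      using u[of "app_iso k a"] hk[OF that] that by (metis UnI2 app_iso_minus_cancel(1) imageI)
    then show "- k + - u + k' \<in> fixator A" by (simp add: fixator_def del: add_uminus_conv_diff)
    show "k' = u + k + (- k + - u + k')" by (simp add: add.assoc del: add_uminus_conv_diff)
  qed
qed

text \<open>The copies \<open>e i\<close> of \<open>A\<close> are placed relative to each other as in the \<open>l\<^sup>1\<close>-product of \<open>A\<close> with
  the index space \<open>w\<close>, truncated at \<open>1\<close>.\<close>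
lemma amalgam_of_copies:
  fixes A :: "'a::metric_space set" and w :: "'i::countable \<Rightarrow> 'i \<Rightarrow> real"
  assumes U: "urysohn_space_1 TYPE('a)" and A: "finite A"
    and w: "\<And>i. w i i = 0" "\<And>i j. i \<noteq> j \<Longrightarrow> w i j > 0" "\<And>i j. w i j = w j i"
      "\<And>i j k. w i k \<le> w i j + w j k"
  obtains e :: "'i \<Rightarrow> 'a isometry"
  where "\<And>i j a b. \<lbrakk>a \<in> A; b \<in> A\<rbrakk> \<Longrightarrow>
    dist (app_iso (e i) a) (app_iso (e j) b) = min 1 (dist a b + w i j)"
proof -
  have diam: "dist a b \<le> 1" for a b :: 'a
  proof -
    have "ereal (dist a b) \<le> mdiameter (euclidean_metric :: 'a metric)"
      unfolding mdiameter_def by (intro SUP_upper2[of a] SUP_upper2[of b]) auto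
    then show ?thesis using U by (simp add: urysohn_space_1_def)
  qed
  have w_nonneg: "w i j \<ge> 0" for i j using w(1,2) by (cases "i = j") (auto simp: less_imp_le)
  have w_zero: "w i j = 0 \<longleftrightarrow> i = j" for i j using w(1,2) by (metis less_irrefl)
  \<comment> \<open>The additional point \<open>None\<close> has distance one from all others, so that the diameter is exactly
    one; inserting \<open>undefined\<close> ensures that there are other points even if \<open>A\<close> is empty.\<close>
  define N where "N = insert None (Some ` (insert undefined A \<times> (UNIV :: 'i set)))"
  define D :: "('a \<times> 'i) option \<Rightarrow> ('a \<times> 'i) option \<Rightarrow> real" where
    "D p q = (case p of None \<Rightarrow> (case q of None \<Rightarrow> 0 | Some _ \<Rightarrow> 1)
      | Some (a, i) \<Rightarrow> (case q of None \<Rightarrow> 1 | Some (b, j) \<Rightarrow> min 1 (dist a b + w i j)))" for p q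
  have D_simps: "D None None = 0" "D None (Some p) = 1" "D (Some p) None = 1"
    "D (Some (a, i)) (Some (b, j)) = min 1 (dist a b + w i j)" for p a i b j
    by (simp_all add: D_def split: prod.split)
  have D_le: "D p q \<le> 1" for p q
    by (simp add: D_def split: option.split prod.split)
  have truncate: "min 1 x \<le> min 1 y + min 1 z" if "x \<le> y + z" "0 \<le> y" "0 \<le> z" for x y z :: real
    using that by (auto simp: min_def)
  have M: "Metric_space N D"
  proof
    fix p q
    show "0 \<le> D p q"
      using w_nonneg by (simp add: D_def split: option.split prod.split)
    show "D p q = D q p"
      by (auto simp: D_def dist_commute w(3) split: option.split prod.split)
    show "D p q = 0 \<longleftrightarrow> p = q"
    proof (cases p; cases q)
      fix s t assume "p = Some s" "q = Some t"
      then show ?thesis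
        using w_nonneg[of "snd s" "snd t"]
        by (cases s; cases t) (auto simp: D_simps min_def add_nonneg_eq_0_iff w_zero w(1))
    qed (auto simp: D_simps)
  next
    fix p q r
    show "D p r \<le> D p q + D q r"
    proof (cases p; cases q; cases r)
      fix s t u assume "p = Some s" "q = Some t" "r = Some u"
      moreover have "dist (fst s) (fst u) + w (snd s) (snd u) \<le>
          (dist (fst s) (fst t) + w (snd s) (snd t)) + (dist (fst t) (fst u) + w (snd t) (snd u))"
        using w(4)[of "snd s" "snd u" "snd t"] dist_triangle[of "fst s" "fst u" "fst t"] by simp
      then have "min 1 (dist (fst s) (fst u) + w (snd s) (snd u)) \<le>
          min 1 (dist (fst s) (fst t) + w (snd s) (snd t)) + min 1 (dist (fst t) (fst u) + w (snd t) (snd u))"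
        by (rule truncate) (simp_all add: w_nonneg)
      ultimately show ?thesis by (cases s; cases t; cases u) (simp add: D_simps)
    qed (use w_nonneg D_le in \<open>auto simp: D_simps add_increasing\<close>)
  qed
  interpret Metric_space N D by (rule M)
  define m where "m = metric (N, D)"
  have m: "mspace m = N" "mdist m = D" "mtopology_of m = mtopology"
    by (simp_all add: m_def mtopology_of_def)
  have "countable N"
    using A by (auto simp: N_def intro: countable_finite)
  then have "separable_space (mtopology_of m)"
    unfolding separable_space_def m(3)
    by (intro exI[of _ N]) (simp add: closure_of_topspace[of mtopology, simplified])
  moreover have "mdiameter m = 1"
  proof (rule antisym)
    show "mdiameter m \<le> 1"
      unfolding mdiameter_def m by (intro SUP_least) (simp add: D_le one_ereal_def)
    show "1 \<le> mdiameter m"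
      unfolding mdiameter_def m
      by (intro SUP_upper2[of None] SUP_upper2[of "Some (undefined, undefined)"])
        (auto simp: N_def D_simps one_ereal_def)
  qed
  ultimately obtain \<phi> where "isometric_embedding m (euclidean_metric :: 'a metric) \<phi>"
    using urysohn_space_1_universal[OF U] by blast
  then have \<phi>: "dist (\<phi> (Some (a, i))) (\<phi> (Some (b, j))) = min 1 (dist a b + w i j)"
    if "a \<in> A" "b \<in> A" for a b i j
    using that by (auto simp: isometric_embedding_def m N_def D_simps)
  have "\<exists>g :: 'a isometry. \<forall>a\<in>A. app_iso g a = \<phi> (Some (a, i))" for i
  proof (rule partial_isometry_extends[OF U A])
    show "\<forall>x\<in>A. \<forall>y\<in>A. dist (\<phi> (Some (x, i))) (\<phi> (Some (y, i))) = dist x y"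
      using diam by (simp add: \<phi> w(1))
  qed blast
  then obtain e where "\<And>i a. a \<in> A \<Longrightarrow> app_iso (e i) a = \<phi> (Some (a, i))" by metis
  then show ?thesis using \<phi> by (intro that[of e]) simp
qed

section \<open>Displacing a finite set by a constant\<close>

text \<open>The copy of \<open>A\<close> under \<open>k\<close> is a parallel copy at height \<open>c\<close>: for \<open>c > 0\<close> the distances are
  those between the two levels of \<open>A \<times> {0, c}\<close> with the \<open>l\<^sup>1\<close>-metric, truncated at \<open>1\<close>.\<close>
definition displaces :: "'a set \<Rightarrow> real \<Rightarrow> 'a::metric_space isometry \<Rightarrow> bool" where
  "displaces A c k \<longleftrightarrow> (\<forall>a\<in>A. \<forall>b\<in>A. dist (app_iso k a) b = min 1 (dist a b + c))"

text \<open>The index space has points \<open>x\<^sub>n\<close> (second component \<open>False\<close>) and \<open>y\<^sub>m\<close> (\<open>True\<close>), where distinct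
  points of the same kind are \<open>2 * c\<close> apart and \<open>x\<^sub>n\<close>, \<open>y\<^sub>m\<close> have distance \<open>c\<close> for \<open>m < n\<close> and
  \<open>3 * c\<close> otherwise.  The distance \<open>3 * c\<close> is the largest possible one: any larger value would
  for \<open>0 < n \<le> m\<close> violate the triangle inequality along a path \<open>x\<^sub>n\<close>, \<open>y\<^sub>j\<close>, \<open>x\<^sub>i\<close>, \<open>y\<^sub>m\<close> with
  \<open>j < n\<close> and \<open>m < i\<close>.  The isometry \<open>h m\<close> moves \<open>A\<close> to the copy at \<open>y\<^sub>m\<close>, and \<open>g n\<close> is the inverse
  of one that moves \<open>A\<close> to the copy at \<open>x\<^sub>n\<close>.\<close>
lemma ordered_displacements:
  fixes A :: "'a::metric_space set"
  assumes U: "urysohn_space_1 TYPE('a)" and A: "finite A" and "c > 0"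
  obtains g h :: "nat \<Rightarrow> 'a isometry"
  where "\<And>n m. m < n \<Longrightarrow> displaces A c (g n + h m)"
    and "\<And>n m. n < m \<Longrightarrow> displaces A (3 * c) (g n + h m)"
proof -
  define w :: "nat \<times> bool \<Rightarrow> nat \<times> bool \<Rightarrow> real" where
    "w = (\<lambda>(n, s) (m, t). if (n, s) = (m, t) then 0 else if s = t then 2 * c
       else if (if s then n < m else m < n) then c else 3 * c)"
  obtain e :: "nat \<times> bool \<Rightarrow> 'a isometry" where e: "\<And>i j a b. \<lbrakk>a \<in> A; b \<in> A\<rbrakk> \<Longrightarrow>
    dist (app_iso (e i) a) (app_iso (e j) b) = min 1 (dist a b + w i j)"
  proof (rule amalgam_of_copies[OF U A, of w])
    fix i j k
    show "w i i = 0" by (simp add: w_def split: prod.split)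
    show "w i j > 0" if "i \<noteq> j" using that \<open>c > 0\<close> by (auto simp: w_def split: prod.split)
    show "w i j = w j i" by (auto simp: w_def split: prod.split)
    show "w i k \<le> w i j + w j k"
      using \<open>c > 0\<close> by (auto simp: w_def split: prod.split)
  qed blast
  have "dist (app_iso (- e (n, False) + e (m, True)) a) b = min 1 (dist a b + w (m, True) (n, False))"
    if "a \<in> A" "b \<in> A" for a b n m
    using e[OF that] by (simp add: dist_app_iso_left[of "- e (n, False)"])
  then show ?thesis
    by (intro that[of "\<lambda>n. - e (n, False)" "\<lambda>m. e (m, True)"]) (auto simp: displaces_def w_def)
qed

text \<open>Above the diagonal all products \<open>g n + h m\<close> lie in the double coset of \<open>k\<close>, below it they
  displace \<open>A\<close> by \<open>c\<close>; \<open>order_gap\<close> compares the two values.\<close>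
lemma value_at_tripled_displacement:
  fixes f :: "'a::metric_space isometry \<Rightarrow> real"
  assumes U: "urysohn_space_1 TYPE('a)" and gf: "grothendieck_function f M"
    and A: "finite A" and "c > 0"
    and inv: "\<And>u v x. \<lbrakk>u \<in> fixator A; v \<in> fixator A\<rbrakk> \<Longrightarrow> \<bar>f (u + x + v) - f x\<bar> \<le> e"
    and near: "\<And>k. displaces A c k \<Longrightarrow> \<bar>f k - \<alpha>\<bar> \<le> p"
    and k: "displaces A (3 * c) k"
  shows "\<bar>f k - \<alpha>\<bar> \<le> p + e"
proof -
  obtain g h :: "nat \<Rightarrow> 'a isometry"
    where below: "\<And>n m. m < n \<Longrightarrow> displaces A c (g n + h m)"
      and above: "\<And>n m. n < m \<Longrightarrow> displaces A (3 * c) (g n + h m)"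
    using ordered_displacements[OF U A \<open>c > 0\<close>] by blast
  have "\<bar>\<alpha> - f k\<bar> \<le> p + e"
  proof (rule grothendieck_function.order_gap[OF gf])
    show "\<bar>f (g n + h m) - \<alpha>\<bar> \<le> p" if "m < n" for n m
      by (rule near[OF below[OF that]])
    show "\<bar>f (g n + h m) - f k\<bar> \<le> e" if "n < m" for n m
    proof (rule same_matrix_imp_same_double_coset[OF U A])
      show "dist (app_iso k a) b = dist (app_iso (g n + h m) a) b" if "a \<in> A" "b \<in> A" for a b
        using k above[OF \<open>n < m\<close>] that by (simp only: displaces_def)
    qed (use inv in simp)
  qed
  then show ?thesis by simp
qed

text \<open>The number \<open>N\<close> of triplings depends only on the neighbourhood of the identity supplied by
  continuity.  It is therefore known before the finite set is enlarged to make \<open>f\<close> nearly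
  bi-invariant with an error so small that \<open>N\<close> such errors add up to at most \<open>e / 2\<close>.\<close>
lemma value_at_far_displacement:
  fixes f :: "'a::metric_space isometry \<Rightarrow> real"
  assumes U: "urysohn_space_1 TYPE('a)" and gf: "grothendieck_function f M" and "e > 0"
  obtains A where "finite A"
    "\<And>k. (\<And>a b. \<lbrakk>a \<in> A; b \<in> A\<rbrakk> \<Longrightarrow> dist (app_iso k a) b = 1) \<Longrightarrow> \<bar>f k - f 0\<bar> \<le> e"
proof -
  interpret grothendieck_function f M by (rule gf)
  have complete: "complete (UNIV :: 'a set)" and separable: "separable_space (euclidean :: 'a topology)"
    using U by (simp_all add: urysohn_space_1_def)
  have "open {x. \<bar>f x - f 0\<bar> < e / 2}"
    by (intro open_Collect_less continuous_intros cont)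
  moreover have "0 \<in> {x. \<bar>f x - f 0\<bar> < e / 2}" using \<open>e > 0\<close> by simp
  ultimately obtain A0 \<delta> where A0: "finite A0" "\<delta> > 0"
    "\<And>k. (\<And>a. a \<in> A0 \<Longrightarrow> dist (app_iso k a) (app_iso 0 a) < \<delta>) \<Longrightarrow> k \<in> {x. \<bar>f x - f 0\<bar> < e / 2}"
    by (rule isometry_neighbourhood) blast
  define c where "c = \<delta> / 2"
  have c: "0 < c" "c < \<delta>" using A0(2) by (simp_all add: c_def)
  obtain N where N: "1 / c < 3 ^ N"
    using real_arch_pow[of 3 "1 / c"] by auto
  have "e / (2 * Suc N) > 0" using \<open>e > 0\<close> by simp
  from nearly_fixator_biinvariant[OF complete separable gf this] obtain A1 where A1: "finite A1"
    "\<And>u v x. \<lbrakk>u \<in> fixator A1; v \<in> fixator A1\<rbrakk> \<Longrightarrow> \<bar>f (u + x + v) - f x\<bar> \<le> e / (2 * Suc N)"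
    by blast
  define A where "A = A0 \<union> A1"
  have "finite A" using A0(1) A1(1) by (simp add: A_def)
  have inv: "\<bar>f (u + x + v) - f x\<bar> \<le> e / (2 * Suc N)" if "u \<in> fixator A" "v \<in> fixator A" for u v x
    using that A1(2) fixator_antimono[of A1 A] by (auto simp: A_def)
  have chain: "\<bar>f k - f 0\<bar> \<le> e / 2 + i * (e / (2 * Suc N))" if "displaces A (3 ^ i * c) k" for k i
    using that
  proof (induction i arbitrary: k)
    case 0
    have "dist (app_iso k a) (app_iso 0 a) < \<delta>" if "a \<in> A0" for a
      using 0 that c by (auto simp: displaces_def A_def)
    from A0(3)[OF this] show ?case by simp
  next
    case (Suc i)
    have "\<bar>f k - f 0\<bar> \<le> (e / 2 + i * (e / (2 * Suc N))) + e / (2 * Suc N)"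
      using Suc c
      by (intro value_at_tripled_displacement[OF U gf \<open>finite A\<close> _ inv, of "3 ^ i * c"])
        (simp_all add: mult.assoc)
    then show ?case by (simp add: algebra_simps add_divide_distrib)
  qed
  show ?thesis
  proof (rule that[OF \<open>finite A\<close>])
    fix k :: "'a isometry" assume far: "\<And>a b. \<lbrakk>a \<in> A; b \<in> A\<rbrakk> \<Longrightarrow> dist (app_iso k a) b = 1"
    have "3 ^ N * c \<ge> 1" using N c by (simp add: field_simps)
    then have "displaces A (3 ^ N * c) k"
      using far by (auto simp: displaces_def min_def add_increasing)
    then have "\<bar>f k - f 0\<bar> \<le> e / 2 + N * (e / (2 * Suc N))" by (rule chain)
    also have "\<dots> \<le> e"
      using \<open>e > 0\<close> by (simp add: field_simps)
    finally show "\<bar>f k - f 0\<bar> \<le> e" .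
  qed
qed

text \<open>Adding \<open>app_iso (- g) ` A\<close> to the displaced set ensures that \<open>g + k\<close>, as well as \<open>k\<close>, moves \<open>A\<close> to
  distance one from itself.\<close>
lemma grothendieck_function_constant:
  fixes f :: "'a::metric_space isometry \<Rightarrow> real"
  assumes U: "urysohn_space_1 TYPE('a)" and gf: "grothendieck_function f M"
  shows "f g = f 0"
proof -
  have "dist (f g) (f 0) \<le> e" if "e > 0" for e
  proof -
    have "e / 2 > 0" using that by simp
    from value_at_far_displacement[OF U gf this] obtain A where A: "finite A"
      "\<And>k. (\<And>a b. \<lbrakk>a \<in> A; b \<in> A\<rbrakk> \<Longrightarrow> dist (app_iso k a) b = 1) \<Longrightarrow> \<bar>f k - f 0\<bar> \<le> e / 2"
      by blast
    from value_at_far_displacement[OF U grothendieck_function.translate[OF gf, of g] \<open>e / 2 > 0\<close>]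
    obtain B where B: "finite B"
      "\<And>k. (\<And>a b. \<lbrakk>a \<in> B; b \<in> B\<rbrakk> \<Longrightarrow> dist (app_iso k a) b = 1) \<Longrightarrow> \<bar>f (g + k) - f (g + 0)\<bar> \<le> e / 2"
      by blast
    let ?C = "A \<union> B \<union> app_iso (- g) ` A"
    obtain p q :: "nat \<Rightarrow> 'a isometry" where "\<And>n m. m < n \<Longrightarrow> displaces ?C 1 (p n + q m)"
      by (rule ordered_displacements[OF U _ zero_less_one, of ?C]) (use A(1) B(1) in auto)
    then have "displaces ?C 1 (p 1 + q 0)" by simp
    then obtain k where k: "\<And>a b. \<lbrakk>a \<in> ?C; b \<in> ?C\<rbrakk> \<Longrightarrow> dist (app_iso k a) b = 1"
      by (intro that[of "p 1 + q 0"]) (simp add: displaces_def min_def)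
    have "\<bar>f (g + k) - f 0\<bar> \<le> e / 2"
      using k by (intro A(2)) (simp add: dist_app_iso_left[of g])
    moreover have "\<bar>f (g + k) - f (g + 0)\<bar> \<le> e / 2"
      using k by (intro B(2)) simp
    ultimately show ?thesis unfolding dist_real_def add_0_right by linarith
  qed
  then show ?thesis by (metis dist_le_zero_iff field_le_epsilon add_0)
qed

theorem corollary1p5:
  assumes "urysohn_space_1 TYPE('a::metric_space)"
  shows "(\<forall>f :: 'a isometry \<Rightarrow>\<^sub>C real.
            weakly_almost_periodic f \<longrightarrow> apply_bcontfun f constant_on UNIV) \<and>
         (\<forall>f :: 'a isometry \<Rightarrow>\<^sub>C complex.
            weakly_almost_periodic f \<longrightarrow> apply_bcontfun f constant_on UNIV)"
proof -
  have const: "l (apply_bcontfun f g) = l (apply_bcontfun f 0)"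
    if wap: "weakly_almost_periodic f" and l: "bounded_linear l"
    for f :: "'a isometry \<Rightarrow>\<^sub>C 'b::real_normed_vector" and l :: "'b \<Rightarrow> real" and g
  proof -
    obtain B where B: "B \<ge> 0" "\<And>x. norm (l x) \<le> norm x * B"
      using bounded_linear.nonneg_bounded[OF l] by blast
    have "grothendieck_function (\<lambda>x. l (apply_bcontfun f x)) (norm f * B)"
    proof
      show "continuous_on UNIV (\<lambda>x. l (apply_bcontfun f x))"
        by (intro bounded_linear.continuous_on[OF l]) simp
      show "\<bar>l (apply_bcontfun f x)\<bar> \<le> norm f * B" for x
        using B(2)[of "apply_bcontfun f x"] mult_right_mono[OF norm_bounded B(1), of f x] by simp
      show "double_limit (\<lambda>x. l (apply_bcontfun f x))"
        by (rule weakly_almost_periodic_imp_double_limit[OF wap l])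
    qed
    then show ?thesis by (rule grothendieck_function_constant[OF assms])
  qed
  show ?thesis
    unfolding constant_on_def
  proof (intro conjI allI impI exI ballI)
    fix f :: "'a isometry \<Rightarrow>\<^sub>C real" and g assume "weakly_almost_periodic f"
    then show "apply_bcontfun f g = apply_bcontfun f 0"
      using const[of f "\<lambda>x. x" g] bounded_linear_ident by blast
  next
    fix f :: "'a isometry \<Rightarrow>\<^sub>C complex" and g assume "weakly_almost_periodic f"
    then show "apply_bcontfun f g = apply_bcontfun f 0"
      using const[of f Re g] const[of f Im g] bounded_linear_Re bounded_linear_Im
      by (intro complex_eqI) blast+
  qed
qed

end
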